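(* Let $r\ge 2$, let $F$ be a group generated by a finite set $A$ with $F_{\mathrm{ab}}\cong\mathbb{Z}^r$, and let $\mathrm{ab}\colon F\to\mathbb{Z}^r$ be the abelianization map. Suppose that there is a symmetric positive definite real $r\times r$ matrix $D$ such that $$\lim_{n\to \infty}\left|(\det D)^{1/2}\, n^{r/2}\left(\frac{\gamma_A(n,\mathrm{ab}^{-1}(\alpha))}{\gamma_A(n,F)}+\frac{\gamma_A(n+1,\mathrm{ab}^{-1}(\alpha))}{\gamma_A(n+1,F)}\right)-\frac{2}{(2\pi)^{r/2}}e^{-\langle \alpha, D^{-1}\alpha\rangle/2n}\right|=0$$ uniformly in $\alpha\in\mathbb{Z}^r$. Let $S\subseteq\mathbb{Z}^r$ be a $G_r$-invariant subset and let $\tilde S=\mathrm{ab}^{-1}(S)$. (i) The strict annular density $\sigma_A(\tilde S)$ exists and, moreover, $\sigma_A(\tilde S)=\rho_\infty(S)$. (ii) Let $U_1$ be the set of visible elements of $\mathbb{Z}^r$, let $V_1=\mathrm{ab}^{-1}(U_1)$ be the set of visible elements of $F$, and let $U_1^{ev}=\{z\in U_1 : \|z\|_1 \text{ is even}\}$. If $\mathrm{ab}^{-1}(U_1^{ev})=\{v\in V_1 : |v|_A\text{ is even}\}$, then $$\lim_{m\to\infty}\frac{\gamma_A(2m,V_1)}{\gamma_A(2m,F)}=2\rho_\infty(U_1^{ev})=\frac{2^r-2}{(2^r-1)\zeta(r)},$$ $$\lim_{m\to\infty}\frac{\gamma_A(2m-1,V_1)}{\gamma_A(2m-1,F)}=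2\rho_\infty(U_1)-2\rho_\infty(U_1^{ev})=\frac{2^r}{(2^r-1)\zeta(r)}.$$
   Context: For a group $F$ with finite generating set $A$, $|w|_A$ is the length of a shortest word in $A^{\pm1}$ representing $w\in F$. For $T\subseteq F$ and $n\ge 0$, $\gamma_A(n,T)=\#\{x\in T: |x|_A=n\}$. The strict annular density of $T\subseteq F$ is $$\sigma_A(T)=\lim_{n\to\infty}\frac12\left(\frac{\gamma_A(n-1,T)}{\gamma_A(n-1,F)}+\frac{\gamma_A(n,T)}{\gamma_A(n,F)}\right),$$ when the limit exists. For $S\subseteq\mathbb{Z}^r$, the strict asymptotic density (with respect to the sup norm) is $$\rho_\infty(S)=\lim_{n\to\infty}\frac{\#\{z\in S:\|z\|_\infty\le n\}}{\#\{z\in\mathbb{Z}^r:\|z\|_\infty\le n\}},$$ when the limit exists; an equality involving $\rho_\infty(S)$ is understood to include the existence of this limit. $F_{\mathrm{ab}}=F/[F,F]$, identified with $\mathbb{Z}^r$. An element $z\in\mathbb{Z}^r$ is visible if it is nonzero and the greatest common divisor of its coordinates is $1$; an element $f\in F$ is visible if $\mathrm{ab}(f)$ is visible. $G_r$ is the group of all $M\in SL(r,\mathbb{Z})$ whose reduction modulo $2$ is the identity matrix, acting on $\mathbb{Z}^r$ linearly. $\langle\cdot,\cdot\rangle$ is the standard inner product on $\mathbb{R}^r$ and $\zeta$ is the Riemann zeta function. *)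

theory Defs
  imports "HOL-Analysis.Analysis" "HOL-Algebra.Generated_Groups"
begin

definition word_length :: "('a, 'b) monoid_scheme \<Rightarrow> 'a set \<Rightarrow> 'a \<Rightarrow> nat" where
  "word_length F A w =
    (LEAST n. \<exists>ws. length ws = n \<and> set ws \<subseteq> A \<union> m_inv F ` A \<and> foldr (mult F) ws (one F) = w)"

definition growth :: "('a, 'b) monoid_scheme \<Rightarrow> 'a set \<Rightarrow> nat \<Rightarrow> 'a set \<Rightarrow> nat" where
  "growth F A n T = card {x \<in> T. word_length F A x = n}"

definition rel_growth :: "('a, 'b) monoid_scheme \<Rightarrow> 'a set \<Rightarrow> nat \<Rightarrow> 'a set \<Rightarrow> real" where
  "rel_growth F A n T = real (growth F A n T) / real (growth F A n (carrier F))"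

text \<open>The natural-number subtraction truncates only at \<open>n = 0\<close>, which does not affect limits.\<close>

definition annular_ratio :: "('a, 'b) monoid_scheme \<Rightarrow> 'a set \<Rightarrow> 'a set \<Rightarrow> nat \<Rightarrow> real" where
  "annular_ratio F A T n = 1/2 * (rel_growth F A (n - 1) T + rel_growth F A n T)"

text \<open>Outside the convergent case the values of the two densities below are unspecified, so
  statements about them come with a separate existence (\<open>convergent\<close>) claim.\<close>

definition has_strict_annular_density :: "('a, 'b) monoid_scheme \<Rightarrow> 'a set \<Rightarrow> 'a set \<Rightarrow> bool" where
  "has_strict_annular_density F A T \<longleftrightarrow> convergent (annular_ratio F A T)"

definition strict_annular_density :: "('a, 'b) monoid_scheme \<Rightarrow> 'a set \<Rightarrow> 'a set \<Rightarrow> real" where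
  "strict_annular_density F A T = lim (annular_ratio F A T)"

definition of_int_vec :: "int ^ 'r \<Rightarrow> real ^ 'r" where
  "of_int_vec z = (\<chi> i. real_of_int (z $ i))"

definition ball_ratio :: "(int ^ 'r) set \<Rightarrow> nat \<Rightarrow> real" where
  "ball_ratio S n =
    real (card {z \<in> S. infnorm (of_int_vec z) \<le> real n}) /
    real (card {z :: int ^ 'r. infnorm (of_int_vec z) \<le> real n})"

definition has_strict_density :: "(int ^ 'r) set \<Rightarrow> bool" where
  "has_strict_density S \<longleftrightarrow> convergent (ball_ratio S)"

definition strict_density :: "(int ^ 'r) set \<Rightarrow> real" where
  "strict_density S = lim (ball_ratio S)"

definition visible :: "int ^ 'r \<Rightarrow> bool" where
  "visible z \<longleftrightarrow> z \<noteq> 0 \<and> Gcd (range (\<lambda>i. z $ i)) = 1"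

definition l1_norm :: "int ^ 'r \<Rightarrow> int" where
  "l1_norm z = (\<Sum>i\<in>UNIV. \<bar>z $ i\<bar>)"

definition visible_vecs :: "(int ^ 'r) set" where
  "visible_vecs = {z. visible z}"

definition even_visible_vecs :: "(int ^ 'r) set" where
  "even_visible_vecs = {z \<in> visible_vecs. even (l1_norm z)}"

definition level2_SL :: "(int ^ 'r ^ 'r) set" where
  "level2_SL = {M. det M = 1 \<and> (\<forall>i j. M $ i $ j mod 2 = (mat 1 :: int ^ 'r ^ 'r) $ i $ j mod 2)}"

definition level2_invariant :: "(int ^ 'r) set \<Rightarrow> bool" where
  "level2_invariant S \<longleftrightarrow> (\<forall>M\<in>level2_SL. \<forall>z\<in>S. M *v z \<in> S)"

definition sym_pos_def :: "real ^ 'r ^ 'r \<Rightarrow> bool" where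
  "sym_pos_def D \<longleftrightarrow> transpose D = D \<and> (\<forall>x. x \<noteq> 0 \<longrightarrow> x \<bullet> (D *v x) > 0)"

definition int_vec_group :: "(int ^ 'r) monoid" where
  "int_vec_group = \<lparr>carrier = UNIV, mult = (+), one = 0\<rparr>"

text \<open>\<open>ab\<close> is the quotient map \<open>F \<rightarrow> F/[F,F]\<close> followed by an identification of \<open>F/[F,F]\<close> with
  \<open>\<int>\<^sup>r\<close>; in particular its existence says that \<open>F/[F,F]\<close> is isomorphic to \<open>\<int>\<^sup>r\<close>.\<close>

definition abelianization_map :: "('a, 'b) monoid_scheme \<Rightarrow> ('a \<Rightarrow> int ^ 'r) \<Rightarrow> bool" where
  "abelianization_map F ab \<longleftrightarrow>
    (\<exists>\<phi> \<in> iso (F Mod derived F (carrier F)) int_vec_group.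
      \<forall>x\<in>carrier F. ab x = \<phi> (derived F (carrier F) #>\<^bsub>F\<^esub> x))"

definition preimage :: "('a, 'b) monoid_scheme \<Rightarrow> ('a \<Rightarrow> int ^ 'r) \<Rightarrow> (int ^ 'r) set \<Rightarrow> 'a set" where
  "preimage F ab S = {x \<in> carrier F. ab x \<in> S}"

text \<open>The Dirichlet series, which converges for the integers \<open>s \<ge> 2\<close> used here.\<close>

definition zeta :: "nat \<Rightarrow> real" where
  "zeta s = (\<Sum>n. 1 / real (Suc n) ^ s)"

end

theory Submission
  imports Defs "HOL-Real_Asymp.Real_Asymp" "HOL-Probability.Probability"
begin

text \<open>Call a sequence of finitely additive weights \<open>\<mu>\<^sub>n\<close> on \<open>\<int>\<^sup>r\<close> admissible if the total masses tend to 1,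
  each translation changes masses by \<open>o(1)\<close>, and the vectors divisible by some \<open>d > K\<close> have
  uniformly small mass for large \<open>K\<close>. For an admissible sequence every periodic set has its obvious
  density, and a sieve gives a limit, independent of the sequence, for each set \<open>d P\<^sub>c\<close>, where \<open>P\<^sub>c\<close>
  consists of the visible vectors congruent to \<open>c\<close> modulo 2. A \<open>G\<^sub>r\<close>-invariant set is, up to the
  origin, a union of sets \<open>d P\<^sub>c\<close>, because visible vectors that agree modulo 2 lie in one
  \<open>G\<^sub>r\<close>-orbit. So it has the same density for all admissible sequences. The uniform weights on
  sup-norm balls are admissible by counting; the annular ratios are admissible because, by the local
  limit theorem, they are close to a rescaled Gaussian density, which is Lipschitz and has integral 1
  (so that no mass escapes). The explicit values come from scaling balls, which shows that \<open>d P\<^sub>c\<close> has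
  \<open>d\<^sup>-\<^sup>r\<close> times the density of \<open>P\<^sub>c\<close>, and from writing a nonzero class modulo 2 as the disjoint union
  of \<open>d P\<^sub>c\<close> over odd \<open>d\<close>.\<close>

section \<open>Admissible sequences of weights\<close>

text \<open>The local limit theorem controls only sums over two consecutive spheres, because word
  length may be tied to the parity of the abelianized vector. Part (ii) must therefore recover
  single spheres from a set on which the parity of the length is known. In the limit the weights are
  not countably additive: points get mass 0 and the whole lattice gets 1. Densities therefore cannot
  simply be summed over all gcds \<open>d\<close>. The uniform bound on vectors with a large common
  divisor replaces countable additivity; it rests on the convergence of the sum of
  \<open>1 / d ^ r\<close>, which is where the rank being at least 2 enters. Classes modulo 2 occur
  because a matrix congruent to the identity modulo 2 cannot change them; the gcd of the entries is
  the other invariant of the action. Quantifying over all admissible sequences avoids computing any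
  density inside the group. Existence comes from a Cauchy argument, and the numbers are found on
  sup-norm balls, where scaling is an exact count.\<close>

definition vec_dvd :: "nat \<Rightarrow> int ^ 'r \<Rightarrow> bool" where
  "vec_dvd d z \<longleftrightarrow> (\<forall>i. int d dvd z $ i)"

definition residue_class :: "nat \<Rightarrow> int ^ 'r \<Rightarrow> (int ^ 'r) set" where
  "residue_class M c = {z. \<forall>i. z $ i mod int M = c $ i mod int M}"

definition residues :: "nat \<Rightarrow> (int ^ 'r) set" where
  "residues M = {z. \<forall>i. 0 \<le> z $ i \<and> z $ i < int M}"

text \<open>Every \<open>d\<close> divides the zero vector, so \<open>divisible_tail K\<close> contains \<open>0\<close>.\<close>

definition divisible_tail :: "nat \<Rightarrow> (int ^ 'r) set" where
  "divisible_tail K = {z. \<exists>d>K. vec_dvd d z}"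

lemma residues_unique:
  assumes "a \<in> residues M" "b \<in> residues M" "z \<in> residue_class M a" "z \<in> residue_class M b"
  shows "a = b"
proof -
  have "a $ i = b $ i" for i
  proof -
    have "a $ i mod int M = b $ i mod int M"
      using assms(3,4)[unfolded residue_class_def, THEN CollectD, THEN spec[of _ i]] by (rule trans[OF sym])
    moreover have "a $ i mod int M = a $ i" "b $ i mod int M = b $ i"
      using assms(1,2) by (auto simp: residues_def)
    ultimately show ?thesis by simp
  qed
  then show ?thesis by (simp add: vec_eq_iff)
qed

lemma residues_reduce:
  assumes "M > 0"
  shows "(\<chi> i. z $ i mod int M) \<in> residues M" "z \<in> residue_class M (\<chi> i. z $ i mod int M)"
    "(\<chi> i. z $ i mod int M) \<in> residue_class M z"
  using assms by (auto simp: residues_def residue_class_def)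

lemma int_vec_box:
  fixes a b :: "int ^ 'r"
  shows "finite {z. \<forall>i. a $ i \<le> z $ i \<and> z $ i \<le> b $ i}"
    and "card {z. \<forall>i. a $ i \<le> z $ i \<and> z $ i \<le> b $ i} = (\<Prod>i\<in>UNIV. nat (b $ i - a $ i + 1))"
proof -
  have eq: "{z. \<forall>i. a $ i \<le> z $ i \<and> z $ i \<le> b $ i} = vec_lambda ` PiE UNIV (\<lambda>i. {a $ i..b $ i})"
    (is "?B = ?C")
  proof (intro Set.set_eqI iffI)
    fix z assume "z \<in> ?B"
    then have "z = vec_lambda (vec_nth z)" "vec_nth z \<in> PiE UNIV (\<lambda>i. {a $ i..b $ i})"
      by auto
    then show "z \<in> ?C" by blast
  qed (auto simp: PiE_iff)
  show "finite ?B"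
    unfolding eq by (intro finite_imageI finite_PiE) auto
  have "inj_on vec_lambda (PiE UNIV (\<lambda>i. {a $ i..b $ i}))"
    by (intro inj_onI) (simp add: vec_lambda_inject)
  then show "card ?B = (\<Prod>i\<in>UNIV. nat (b $ i - a $ i + 1))"
    unfolding eq by (subst card_image) (auto simp: card_PiE intro!: prod.cong)
qed

lemma residues_finite_card:
  "finite (residues M :: (int ^ 'r) set)"
  "card (residues M :: (int ^ 'r) set) = M ^ CARD('r)"
proof -
  have eq: "(residues M :: (int ^ 'r) set)
      = {z. \<forall>i. ((\<chi> i. 0) :: int ^ 'r) $ i \<le> z $ i \<and> z $ i \<le> ((\<chi> i. int M - 1) :: int ^ 'r) $ i}"
    by (simp add: residues_def)
  show "finite (residues M :: (int ^ 'r) set)"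
    unfolding eq by (rule int_vec_box)
  show "card (residues M :: (int ^ 'r) set) = M ^ CARD('r)"
    unfolding eq int_vec_box(2) by simp
qed

section \<open>Finitely additive weights and the admissibility conditions\<close>

locale additive_sequence =
  fixes \<mu> :: "nat \<Rightarrow> (int ^ 'r) set \<Rightarrow> real"
  assumes nonneg: "\<mu> n X \<ge> 0"
    and disj_Un: "X \<inter> Y = {} \<Longrightarrow> \<mu> n (X \<union> Y) = \<mu> n X + \<mu> n Y"
begin

lemma empty: "\<mu> n {} = 0"
  using disj_Un[of "{}" "{}" n] by simp

lemma mono: "X \<subseteq> Y \<Longrightarrow> \<mu> n X \<le> \<mu> n Y"
  using disj_Un[of X "Y - X" n] nonneg[of n "Y - X"] by (simp add: Un_absorb1)

lemma UN_disjoint: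
  assumes "finite I" "disjoint_family_on X I"
  shows "\<mu> n (\<Union>i\<in>I. X i) = (\<Sum>i\<in>I. \<mu> n (X i))"
  using assms
proof (induction I rule: finite_induct)
  case (insert i I)
  then have "X i \<inter> (\<Union>i\<in>I. X i) = {}" "disjoint_family_on X I"
    by (auto simp: disjoint_family_on_def)
  then show ?case using insert by (simp add: disj_Un)
qed (simp add: empty)

lemma symdiff_bound:
  assumes "(X - Y) \<union> (Y - X) \<subseteq> T"
  shows "\<bar>\<mu> n X - \<mu> n Y\<bar> \<le> \<mu> n T"
proof -
  have *: "\<mu> n X - \<mu> n Y \<le> \<mu> n T" if "X - Y \<subseteq> T" for X Y
  proof -
    have "\<mu> n X \<le> \<mu> n (Y \<union> (X - Y))" by (rule mono) auto
    also have "\<dots> = \<mu> n Y + \<mu> n (X - Y)" by (rule disj_Un) auto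
    also have "\<mu> n (X - Y) \<le> \<mu> n T" using that by (rule mono)
    finally show ?thesis by simp
  qed
  show ?thesis using *[of X Y] *[of Y X] assms by auto
qed

end

text \<open>\<open>shift\<close> forces equidistribution among residue classes, \<open>total\<close>
  normalizes it, and \<open>tail\<close> allows the sieve bound \<open>K\<close> and the index
  \<open>n\<close> to go to infinity one after the other.\<close>

locale asymptotic_density = additive_sequence \<mu>
  for \<mu> :: "nat \<Rightarrow> (int ^ 'r) set \<Rightarrow> real" +
  assumes total: "(\<lambda>n. \<mu> n UNIV) \<longlonglongrightarrow> 1"
    and shift: "(\<lambda>n. \<mu> n ((+) t ` X) - \<mu> n X) \<longlonglongrightarrow> 0"
    and tail: "\<epsilon> > 0 \<Longrightarrow> \<exists>K. \<forall>\<^sub>F n in sequentially. \<mu> n (divisible_tail K) < \<epsilon>"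
begin

text \<open>The classes modulo \<open>M\<close> are translates of one another, so their masses agree
  up to \<open>o(1)\<close>; they also add up to the total mass.\<close>

lemma residue_class_limit:
  assumes "M > 0"
  shows "(\<lambda>n. \<mu> n (residue_class M c)) \<longlonglongrightarrow> 1 / real (card (residues M :: (int ^ 'r) set))"
proof -
  let ?R = "residues M :: (int ^ 'r) set"
  have sh: "residue_class M a = (+) (a - c) ` residue_class M c" for a
  proof (intro Set.set_eqI iffI)
    fix z assume z: "z \<in> residue_class M a"
    have "z - (a - c) \<in> residue_class M c"
      using z by (simp add: residue_class_def mod_eq_dvd_iff)
    moreover have "z = (a - c) + (z - (a - c))" by simp
    ultimately show "z \<in> (+) (a - c) ` residue_class M c" by (rule rev_image_eqI)
  next
    fix z assume "z \<in> (+) (a - c) ` residue_class M c"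
    then show "z \<in> residue_class M a"
      by (auto simp: residue_class_def mod_eq_dvd_iff)
  qed
  have U: "UNIV = (\<Union>a\<in>?R. residue_class M a)"
  proof (intro Set.set_eqI iffI)
    fix z :: "int ^ 'r"
    show "z \<in> (\<Union>a\<in>?R. residue_class M a)" using residues_reduce[OF assms, of z] by blast
  qed auto
  have dj: "disjoint_family_on (residue_class M) ?R"
    using residues_unique by (fastforce simp: disjoint_family_on_def)
  have "\<mu> n UNIV = (\<Sum>a\<in>?R. \<mu> n (residue_class M a))" for n
    by (subst U) (rule UN_disjoint[OF residues_finite_card(1) dj])
  \<comment> \<open>Replacing every class by the class of \<open>c\<close> costs exactly the
    subtracted sum, each term of which tends to 0 by \<open>shift\<close>.\<close>
  then have eq: "\<mu> n UNIV - (\<Sum>a\<in>?R. \<mu> n (residue_class M a) - \<mu> n (residue_class M c))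
      = real (card ?R) * \<mu> n (residue_class M c)" for n
    by (simp add: sum_subtractf)
  have "(\<lambda>n. \<mu> n UNIV - (\<Sum>a\<in>?R. \<mu> n (residue_class M a) - \<mu> n (residue_class M c)))
      \<longlonglongrightarrow> 1 - (\<Sum>a\<in>?R. 0)"
    by (intro tendsto_intros total) (subst sh, rule shift)
  then have "(\<lambda>n. real (card ?R) * \<mu> n (residue_class M c)) \<longlonglongrightarrow> 1"
    unfolding eq by simp
  then have "(\<lambda>n. (real (card ?R) * \<mu> n (residue_class M c)) / real (card ?R)) \<longlonglongrightarrow> 1 / real (card ?R)"
    by (intro tendsto_divide tendsto_const) (use assms in \<open>simp_all add: residues_finite_card\<close>)
  then show ?thesis using assms by (simp add: residues_finite_card)
qed

lemma periodic_limit: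
  assumes "M > 0" and X: "\<And>c. c \<in> X \<Longrightarrow> residue_class M c \<subseteq> X"
  shows "(\<lambda>n. \<mu> n X) \<longlonglongrightarrow> real (card (X \<inter> residues M)) / real (card (residues M :: (int ^ 'r) set))"
proof -
  let ?R = "residues M :: (int ^ 'r) set"
  have U: "X = (\<Union>a\<in>X \<inter> ?R. residue_class M a)"
  proof (intro Set.set_eqI iffI)
    fix z assume z: "z \<in> X"
    show "z \<in> (\<Union>a\<in>X \<inter> ?R. residue_class M a)"
      using X[OF z] residues_reduce[OF assms(1), of z] by blast
  qed (use X in auto)
  have dj: "disjoint_family_on (residue_class M) (X \<inter> ?R)"
    using residues_unique by (fastforce simp: disjoint_family_on_def)
  have "\<mu> n X = (\<Sum>a\<in>X \<inter> ?R. \<mu> n (residue_class M a))" for n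
    by (subst U) (rule UN_disjoint[OF _ dj], simp add: residues_finite_card)
  moreover have "(\<lambda>n. \<Sum>a\<in>X \<inter> ?R. \<mu> n (residue_class M a)) \<longlonglongrightarrow> (\<Sum>a\<in>X \<inter> ?R. 1 / real (card ?R))"
    by (intro tendsto_sum residue_class_limit assms)
  ultimately show ?thesis by simp
qed

text \<open>Neither limit is known beforehand. For large \<open>K\<close> and then large
  \<open>n\<close>, the mass of \<open>X\<close> is close to \<open>q K\<close>; comparing two
  values of \<open>K\<close> at one common \<open>n\<close> makes \<open>q\<close> Cauchy. The value
  \<open>lim q\<close> depends on the weights only through \<open>q\<close>, which is what makes
  densities independent of the sequence.\<close>

lemma approximation_limit:
  assumes sd: "\<And>K. (X - Q K) \<union> (Q K - X) \<subseteq> divisible_tail K"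
    and q: "\<And>K. (\<lambda>n. \<mu> n (Q K)) \<longlonglongrightarrow> q K"
  shows "convergent q" "(\<lambda>n. \<mu> n X) \<longlonglongrightarrow> lim q"
proof -
  have ev: "\<exists>K0. \<forall>K\<ge>K0. \<forall>\<^sub>F n in sequentially. \<bar>\<mu> n X - q K\<bar> < \<epsilon>" if "\<epsilon> > 0" for \<epsilon>
  proof -
    obtain K0 where K0: "\<forall>\<^sub>F n in sequentially. \<mu> n (divisible_tail K0) < \<epsilon> / 2"
      using tail[of "\<epsilon> / 2"] \<open>\<epsilon> > 0\<close> by auto
    have "\<forall>\<^sub>F n in sequentially. \<bar>\<mu> n X - q K\<bar> < \<epsilon>" if "K \<ge> K0" for K
    proof -
      have "\<forall>\<^sub>F n in sequentially. dist (\<mu> n (Q K)) (q K) < \<epsilon> / 2"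
        using q[of K] \<open>\<epsilon> > 0\<close> by (intro tendstoD) auto
      with K0 show ?thesis
      proof eventually_elim
        case (elim n)
        have "\<bar>\<mu> n X - \<mu> n (Q K)\<bar> \<le> \<mu> n (divisible_tail K)"
          by (rule symdiff_bound[OF sd])
        also have "\<dots> \<le> \<mu> n (divisible_tail K0)"
          using that by (intro mono) (auto simp: divisible_tail_def intro: le_less_trans)
        finally show ?case using elim unfolding dist_real_def by linarith
      qed
    qed
    then show ?thesis by blast
  qed
  have "Cauchy q"
  proof (rule CauchyI)
    fix \<epsilon> :: real assume "\<epsilon> > 0"
    then obtain K0 where K0: "\<forall>K\<ge>K0. \<forall>\<^sub>F n in sequentially. \<bar>\<mu> n X - q K\<bar> < \<epsilon> / 2"
      using ev[of "\<epsilon> / 2"] by auto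
    have "norm (q K - q L) < \<epsilon>" if "K \<ge> K0" "L \<ge> K0" for K L
    proof -
      have "\<forall>\<^sub>F n in sequentially. \<bar>\<mu> n X - q K\<bar> < \<epsilon> / 2 \<and> \<bar>\<mu> n X - q L\<bar> < \<epsilon> / 2"
        using K0 that by (simp add: eventually_conj)
      then obtain n where "\<bar>\<mu> n X - q K\<bar> < \<epsilon> / 2 \<and> \<bar>\<mu> n X - q L\<bar> < \<epsilon> / 2"
        using eventually_happens'[OF sequentially_bot] by blast
      then show ?thesis by (simp add: abs_if split: if_splits)
    qed
    then show "\<exists>M. \<forall>m\<ge>M. \<forall>n\<ge>M. norm (q m - q n) < \<epsilon>" by blast
  qed
  then show conv: "convergent q" by (simp add: Cauchy_convergent_iff)
  show "(\<lambda>n. \<mu> n X) \<longlonglongrightarrow> lim q"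
  proof (rule tendstoI)
    fix \<epsilon> :: real assume "\<epsilon> > 0"
    then obtain K0 where K0: "\<forall>K\<ge>K0. \<forall>\<^sub>F n in sequentially. \<bar>\<mu> n X - q K\<bar> < \<epsilon> / 2"
      using ev[of "\<epsilon> / 2"] by auto
    have "\<forall>\<^sub>F K in sequentially. dist (q K) (lim q) < \<epsilon> / 2 \<and> K \<ge> K0"
      using conv \<open>\<epsilon> > 0\<close>
      by (intro eventually_conj eventually_ge_at_top tendstoD) (auto simp: convergent_LIMSEQ_iff)
    then obtain K where K: "dist (q K) (lim q) < \<epsilon> / 2" "K \<ge> K0"
      using eventually_happens'[OF sequentially_bot] by blast
    show "\<forall>\<^sub>F n in sequentially. dist (\<mu> n X) (lim q) < \<epsilon>"
      using K0[rule_format, OF K(2)]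
      by eventually_elim (use K(1) in \<open>simp add: dist_real_def abs_if split: if_splits\<close>)
  qed
qed

end

text \<open>Quantifying over all admissible sequences lets a value computed along sup-norm balls be
  transferred to the annular ratios of a group.\<close>

definition has_density :: "(int ^ 'r) set \<Rightarrow> real \<Rightarrow> bool" where
  "has_density X x \<longleftrightarrow> (\<forall>\<mu>. asymptotic_density \<mu> \<longrightarrow> (\<lambda>n. \<mu> n X) \<longlonglongrightarrow> x)"

lemma has_density_UN:
  fixes X :: "'i \<Rightarrow> (int ^ 'r) set"
  assumes "finite I" "disjoint_family_on X I" "\<And>i. i \<in> I \<Longrightarrow> has_density (X i) (x i)"
  shows "has_density (\<Union>i\<in>I. X i) (\<Sum>i\<in>I. x i)"
  unfolding has_density_def
proof (intro allI impI)
  fix \<mu> :: "nat \<Rightarrow> (int ^ 'r) set \<Rightarrow> real" assume m: "asymptotic_density \<mu>"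
  show "(\<lambda>n. \<mu> n (\<Union>i\<in>I. X i)) \<longlonglongrightarrow> (\<Sum>i\<in>I. x i)"
    unfolding additive_sequence.UN_disjoint[OF asymptotic_density.axioms(1)[OF m] assms(1,2)]
    by (intro tendsto_sum) (use assms(3) m in \<open>auto simp: has_density_def\<close>)
qed

lemma has_density_periodic:
  fixes X :: "(int ^ 'r) set"
  assumes "M > 0" "\<And>c. c \<in> X \<Longrightarrow> residue_class M c \<subseteq> X"
  shows "has_density X (real (card (X \<inter> residues M)) / real (card (residues M :: (int ^ 'r) set)))"
  unfolding has_density_def using asymptotic_density.periodic_limit[OF _ assms] by blast

lemma has_density_approximation:
  assumes "\<And>K. (X - Q K) \<union> (Q K - X) \<subseteq> divisible_tail K"
    and "\<And>K. has_density (Q K) (q K)"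
  shows "has_density X (lim q)"
  unfolding has_density_def
  by (intro allI impI asymptotic_density.approximation_limit(2)[OF _ assms(1)])
    (use assms(2) in \<open>auto simp: has_density_def\<close>)

section \<open>Visible vectors\<close>

lemma vec_dvd_0 [simp]: "vec_dvd d 0" "vec_dvd 0 z \<longleftrightarrow> z = 0"
  by (auto simp: vec_dvd_def vec_eq_iff)

text \<open>This form is convenient for sieving. The zero vector needs no separate clause, since it
  is divisible by 2.\<close>

lemma visible_iff: "visible z \<longleftrightarrow> (\<forall>d. vec_dvd d z \<longrightarrow> d = 1)"
proof
  assume v: "visible z"
  show "\<forall>d. vec_dvd d z \<longrightarrow> d = 1"
  proof (intro allI impI)
    fix d assume "vec_dvd d z"
    then have "int d dvd Gcd (range (\<lambda>i. z $ i))"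
      by (auto simp: vec_dvd_def intro!: Gcd_greatest)
    then show "d = 1" using v by (simp add: visible_def)
  qed
next
  assume *: "\<forall>d. vec_dvd d z \<longrightarrow> d = 1"
  have "z \<noteq> 0" using *[rule_format, of 2] by auto
  have "vec_dvd (nat (Gcd (range (\<lambda>i. z $ i)))) z"
    by (simp add: vec_dvd_def Gcd_dvd)
  then have "nat (Gcd (range (\<lambda>i. z $ i))) = 1" using * by blast
  then show "visible z" using \<open>z \<noteq> 0\<close> by (simp add: visible_def)
qed

lemma visible_decomposition:
  fixes z :: "int ^ 'r"
  assumes "z \<noteq> 0"
  obtains d z' where "d > 0" "visible z'" "z = int d *s z'"
proof -
  let ?g = "Gcd (range (\<lambda>i. z $ i))"
  define d where "d = nat ?g"
  obtain i where "z $ i \<noteq> 0" using assms by (auto simp: vec_eq_iff)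
  moreover have "?g dvd z $ i" by (rule Gcd_dvd) simp
  ultimately have g0: "?g \<noteq> 0" by auto
  have d: "int d = ?g" by (simp add: d_def)
  have "int d \<noteq> 0" unfolding d by (rule g0)
  then have "d > 0" by simp
  define z' :: "int ^ 'r" where "z' = (\<chi> i. z $ i div int d)"
  have zz: "z = int d *s z'"
    using d by (auto simp: vec_eq_iff z'_def Gcd_dvd)
  have "visible z'"
    unfolding visible_iff
  proof (intro allI impI)
    fix e assume "vec_dvd e z'"
    then have "int d * int e dvd z $ i" for i
      by (subst zz) (auto simp: vec_dvd_def)
    then have "int d * int e dvd ?g" by (auto intro!: Gcd_greatest)
    then have "int d * int e dvd int d" by (simp add: d)
    then show "e = 1" using \<open>d > 0\<close> by simp
  qed
  with \<open>d > 0\<close> zz show ?thesis using that by blast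
qed

lemma visible_multiple_dvd:
  assumes "visible z" "vec_dvd d (int e *s z)"
  shows "d dvd e"
proof -
  have "int d dvd Gcd ((*) (int e) ` range (\<lambda>i. z $ i))"
    using assms(2) by (intro Gcd_greatest) (auto simp: vec_dvd_def)
  also have "\<dots> = int e" using assms(1) by (simp add: Gcd_mult visible_def)
  finally show ?thesis by simp
qed

text \<open>Both multipliers are the gcd of the entries of the common vector. This is what makes the
  layers of the lattice by gcd disjoint.\<close>

lemma visible_multiple_unique:
  assumes "visible z" "visible w" "d > 0" "int d *s z = int e *s w"
  shows "d = e \<and> z = w"
proof -
  have "vec_dvd d (int d *s z)" "vec_dvd e (int e *s w)" by (auto simp: vec_dvd_def)
  then have "d = e"
    using visible_multiple_dvd assms dvd_antisym by metis
  with assms(3,4) show ?thesis by (auto simp: vec_eq_iff)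
qed

text \<open>This is the set \<open>d P_c\<close> of the overview. The class \<open>c\<close> is that
  of the visible vector, not of its multiple, so it remains informative when \<open>d\<close> is
  even.\<close>

definition visible_multiples :: "nat \<Rightarrow> int ^ 'r \<Rightarrow> (int ^ 'r) set" where
  "visible_multiples d c = (\<lambda>z. int d *s z) ` {z \<in> residue_class 2 c. visible z}"

text \<open>Visibility is an infinite condition; truncating it to divisors up to \<open>K\<close>
  gives a periodic set, and what the truncation wrongly admits has a common divisor above
  \<open>K\<close>. Only existence is obtained here.\<close>

lemma has_density_visible_multiples:
  fixes c :: "int ^ 'r"
  assumes "d > 0"
  obtains x where "has_density (visible_multiples d c) x"
proof -
  define Q where "Q K = (\<lambda>z. int d *s z) ` {z \<in> residue_class 2 c. \<forall>e\<in>{2..K}. \<not> vec_dvd e z}" for K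
  have "\<exists>q. has_density (Q K) q" for K
  proof -
    \<comment> \<open>In the period, \<open>d\<close> preserves being a multiple of
      \<open>d\<close>, the factor 2 preserves the class of the quotient, and \<open>fact K\<close>
      is divisible by every \<open>e\<close> up to \<open>K\<close>, so the sieve conditions are
      preserved too.\<close>
    have "has_density (Q K) (real (card (Q K \<inter> residues (d * (2 * fact K))))
        / real (card (residues (d * (2 * fact K)) :: (int ^ 'r) set)))"
    proof (rule has_density_periodic)
      fix w assume "w \<in> Q K"
      then obtain z where z: "z \<in> residue_class 2 c" "\<forall>e\<in>{2..K}. \<not> vec_dvd e z" "w = int d *s z"
        by (auto simp: Q_def)
      show "residue_class (d * (2 * fact K)) w \<subseteq> Q K"
      proof
        fix w' assume "w' \<in> residue_class (d * (2 * fact K)) w"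
        then have "int d * (2 * fact K) dvd w' $ i - w $ i" for i
          by (simp add: residue_class_def mod_eq_dvd_iff)
        then have "\<exists>t. w' $ i - w $ i = int d * (2 * fact K) * t" for i by (auto elim: dvdE)
        then obtain t where t: "\<And>i. w' $ i - w $ i = int d * (2 * fact K) * t i" by metis
        define z' where "z' = z + (\<chi> i. 2 * fact K * t i)"
        have zi: "z' $ i - z $ i = fact K * (2 * t i)" for i by (simp add: z'_def)
        have w': "w' = int d *s z'"
          unfolding vec_eq_iff
        proof
          fix i show "w' $ i = (int d *s z') $ i" using t[of i] by (simp add: z'_def z(3) algebra_simps)
        qed
        have "z' \<in> residue_class 2 c"
          using z(1) by (simp add: residue_class_def z'_def mod_mult_left_eq mult.assoc)
        moreover have "\<not> vec_dvd e z'" if e: "e \<in> {2..K}" for e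
        proof
          assume v: "vec_dvd e z'"
          have "int e dvd fact K" using e by (metis atLeastAtMost_iff dvd_fact of_nat_dvd_iff of_nat_fact one_le_numeral order_trans)
          then have "int e dvd z' $ i - z $ i" for i unfolding zi by (rule dvd_mult2)
          with v have "vec_dvd e z"
            unfolding vec_dvd_def by (metis dvd_diff diff_diff_eq2 add_diff_cancel_left')
          with z(2) e show False by blast
        qed
        ultimately show "w' \<in> Q K" unfolding Q_def w' by blast
      qed
    qed (use assms in simp)
    then show ?thesis by blast
  qed
  then obtain q where q: "\<And>K. has_density (Q K) (q K)" by metis
  have sub: "visible_multiples d c \<subseteq> Q K" for K
    by (force simp: visible_multiples_def Q_def visible_iff)
  have "Q K - visible_multiples d c \<subseteq> divisible_tail K" for K
  proof
    fix w assume w: "w \<in> Q K - visible_multiples d c"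
    then obtain z where z: "z \<in> residue_class 2 c" "\<forall>e\<in>{2..K}. \<not> vec_dvd e z" "w = int d *s z"
      by (auto simp: Q_def)
    then have "\<not> visible z" using w by (auto simp: visible_multiples_def)
    then obtain e where e: "vec_dvd e z" "e \<noteq> 1" by (auto simp: visible_iff)
    show "w \<in> divisible_tail K"
    \<comment> \<open>The zero vector passes the truncated sieve when \<open>K < 2\<close>, since
      then \<open>{2..K}\<close> is empty.\<close>
    proof (cases "z = 0")
      case True
      then show ?thesis using z(3) by (auto simp: divisible_tail_def vec_dvd_def)
    next
      case False
      then have "e \<noteq> 0" using e(1) by (metis vec_dvd_0(2))
      then have "e \<ge> 2" using e(2) by simp
      then have "e > K" using e z(2) by (meson atLeastAtMost_iff not_le)
      moreover have "vec_dvd e w" using e(1) z(3) by (auto simp: vec_dvd_def)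
      ultimately show ?thesis by (auto simp: divisible_tail_def)
    qed
  qed
  then have "has_density (visible_multiples d c) (lim q)"
    using sub by (intro has_density_approximation[OF _ q]) blast
  then show ?thesis by (rule that)
qed

lemma visible_multiples_disjoint:
  assumes "d > 0" "(d, c) \<noteq> (e, c')" "c \<in> residues 2" "c' \<in> residues 2"
  shows "visible_multiples d c \<inter> visible_multiples e c' = {}"
proof (rule ccontr)
  assume "visible_multiples d c \<inter> visible_multiples e c' \<noteq> {}"
  then obtain z w where zw: "z \<in> residue_class 2 c" "visible z" "w \<in> residue_class 2 c'" "visible w"
      "int d *s z = int e *s w"
    unfolding visible_multiples_def by blast
  then have "d = e" "z = w" using visible_multiple_unique assms(1) by blast+
  then show False using residues_unique assms zw by blast
qed

text \<open>Odd multiples stay in their class modulo 2 and even multiples fall into the class of 0.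
  So for nonzero \<open>c\<close> the gcd of a vector in the class is odd, and the union misses only
  vectors whose gcd exceeds \<open>K\<close>.\<close>

lemma residue_class_2_approximation:
  fixes c :: "int ^ 'r"
  assumes "c \<in> residues 2" "c \<noteq> 0"
  defines "Q \<equiv> \<lambda>K. \<Union>d\<in>{d. odd d \<and> d \<le> K}. visible_multiples d c"
  shows "(residue_class 2 c - Q K) \<union> (Q K - residue_class 2 c) \<subseteq> divisible_tail K"
proof -
  have odd_mult: "int d *s z \<in> residue_class 2 c \<longleftrightarrow> z \<in> residue_class 2 c" if "odd d" for d z
  proof -
    have "int d * z $ i mod 2 = z $ i mod 2" for i
      using that by (simp add: mod_eq_dvd_iff)
    then show ?thesis by (simp add: residue_class_def)
  qed
  have "Q K \<subseteq> residue_class 2 c"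
    using odd_mult by (auto simp: Q_def visible_multiples_def)
  moreover have "residue_class 2 c - Q K \<subseteq> divisible_tail K"
  proof
    fix w assume w: "w \<in> residue_class 2 c - Q K"
    have nz: "0 \<notin> residue_class 2 c"
    proof
      assume "0 \<in> residue_class 2 c"
      then have "c = 0" using residues_unique[of c 2 0 0] assms(1) by (auto simp: residues_def residue_class_def)
      then show False using assms by simp
    qed
    then have "w \<noteq> 0" using w by auto
    then obtain d z where dz: "d > 0" "visible z" "w = int d *s z" by (rule visible_decomposition)
    have "odd d"
    proof
      assume "even d"
      then have "0 \<in> residue_class 2 c"
        using w dz(3) by (auto simp: residue_class_def)
      then show False using nz by simp
    qed
    then have "w \<in> visible_multiples d c"
      using w dz odd_mult by (auto simp: visible_multiples_def)
    then have "d > K" using w \<open>odd d\<close> by (auto simp: Q_def simp flip: not_le)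
    moreover have "vec_dvd d w" by (simp add: dz vec_dvd_def)
    ultimately show "w \<in> divisible_tail K" by (auto simp: divisible_tail_def)
  qed
  ultimately show ?thesis by blast
qed

text \<open>The even terms are the whole series multiplied by \<open>1 / 2 ^ s\<close>; subtracting
  them leaves the odd ones.\<close>

lemma odd_zeta_sums:
  assumes "s \<ge> 2"
  shows "(\<lambda>n. if odd n then 1 / real n ^ s else 0) sums ((1 - 1 / 2 ^ s) * zeta s)"
    and "zeta s > 0"
proof -
  define g where "g n = 1 / real n ^ s" for n
  \<comment> \<open>Division by zero yields 0, so the series may start at index 0 without changing
    its sum.\<close>
  have g0: "g 0 = 0" using assms by (simp add: g_def)
  have sm: "summable g"
    using inverse_power_summable[of s, where 'a = real] assms by (simp add: g_def[abs_def] inverse_eq_divide)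
  then have "summable (\<lambda>n. g (Suc n))" by (simp add: summable_Suc_iff)
  then have "(\<lambda>n. g (Suc n)) sums zeta s" by (simp add: zeta_def g_def summable_sums)
  then have g: "g sums zeta s" using g0 by (simp add: sums_Suc_iff)
  have "0 < (\<Sum>n. g (Suc n))"
    using \<open>summable (\<lambda>n. g (Suc n))\<close> by (intro suminf_pos) (auto simp: g_def)
  then show "zeta s > 0" by (simp add: zeta_def g_def)
  have "(\<lambda>n. if even n then g n else 0) sums (1 / 2 ^ s * zeta s)"
  proof -
    have "(\<lambda>n. (if even (2 * n) then g (2 * n) else 0)) sums (1 / 2 ^ s * zeta s)"
      using sums_mult[OF g, of "1 / 2 ^ s"] by (simp add: g_def power_mult_distrib)
    then show ?thesis
      by (subst (asm) sums_mono_reindex[where g = "\<lambda>n. 2 * n"])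
        (auto simp: strict_mono_def elim!: evenE)
  qed
  from sums_diff[OF g this] have "(\<lambda>n. g n - (if even n then g n else 0)) sums ((1 - 1 / 2 ^ s) * zeta s)"
    by (simp add: algebra_simps)
  moreover have "(\<lambda>n. g n - (if even n then g n else 0)) = (\<lambda>n. if odd n then 1 / real n ^ s else 0)"
    by (auto simp: g_def)
  ultimately show "(\<lambda>n. if odd n then 1 / real n ^ s else 0) sums ((1 - 1 / 2 ^ s) * zeta s)" by simp
qed

section \<open>Orbits of the level 2 subgroup\<close>

definition vec_upd :: "'a ^ 'r \<Rightarrow> 'r \<Rightarrow> 'a \<Rightarrow> 'a ^ 'r" where
  "vec_upd v j x = (\<chi> a. if a = j then x else v $ a)"

text \<open>The coefficient \<open>2 * k\<close> is even, so this elementary row operation has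
  determinant 1 and is the identity modulo 2. Invariance is assumed in one direction only; the
  converse uses the inverse operation, with \<open>- k\<close>.\<close>

lemma level2_invariant_transvection:
  fixes v :: "int ^ 'r"
  assumes S: "level2_invariant S" and "i \<noteq> j"
  shows "vec_upd v j (v $ j + 2 * k * v $ i) \<in> S \<longleftrightarrow> v \<in> S"
proof -
  have *: "vec_upd v j (v $ j + 2 * k * v $ i) \<in> S" if "v \<in> S" for v k
  proof -
    define M :: "int ^ 'r ^ 'r"
      where "M = (\<chi> l. if l = j then row j (mat 1) + (2 * k) *s row i (mat 1) else row l (mat 1))"
    have Mab: "M $ a $ b = (if a = b then 1 else 0) + (if a = j \<and> b = i then 2 * k else 0)" for a b
      by (auto simp: M_def row_def mat_def)
    have "det M = det (mat 1 :: int ^ 'r ^ 'r)"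
      unfolding M_def using \<open>i \<noteq> j\<close> by (intro det_row_operation) auto
    then have "det M = 1" by simp
    then have "M \<in> level2_SL"
      by (auto simp: level2_SL_def Mab mat_def)
    moreover have "M *v v = vec_upd v j (v $ j + 2 * k * v $ i)"
    proof (subst vec_eq_iff, rule allI)
      fix a
      have "(M *v v) $ a = (\<Sum>b\<in>UNIV. (if a = b then v $ b else 0) + (if b = i then (if a = j then 2 * k * v $ b else 0) else 0))"
        unfolding matrix_vector_mult_def by (auto simp: Mab algebra_simps intro!: sum.cong)
      also have "\<dots> = v $ a + (if a = j then 2 * k * v $ i else 0)"
        by (simp add: sum.distrib)
      finally show "(M *v v) $ a = vec_upd v j (v $ j + 2 * k * v $ i) $ a"
        by (simp add: vec_upd_def)
    qed
    ultimately show ?thesis using S that unfolding level2_invariant_def by metis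
  qed
  have "vec_upd (vec_upd v j (v $ j + 2 * k * v $ i)) j
      (vec_upd v j (v $ j + 2 * k * v $ i) $ j + 2 * (-k) * vec_upd v j (v $ j + 2 * k * v $ i) $ i) = v"
    using \<open>i \<noteq> j\<close> by (simp add: vec_upd_def vec_eq_iff)
  then show ?thesis using * by metis
qed

text \<open>Changing one sign alone has determinant -1. A second sign is changed at
  \<open>i\<close>, where it has no effect because the entry is 0.\<close>

lemma level2_invariant_sign_flip:
  fixes v :: "int ^ 'r"
  assumes S: "level2_invariant S" and "i \<noteq> j" "v $ i = 0"
  shows "vec_upd v j (- v $ j) \<in> S \<longleftrightarrow> v \<in> S"
proof -
  have *: "vec_upd v j (- v $ j) \<in> S" if "v \<in> S" "v $ i = 0" for v
  proof -
    define M :: "int ^ 'r ^ 'r"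
      where "M = (\<chi> a b. if a = b then (if a = i \<or> a = j then -1 else 1) else 0)"
    have "det M = (\<Prod>a\<in>UNIV. M $ a $ a)"
      by (rule det_diagonal) (auto simp: M_def)
    also have "\<dots> = (\<Prod>a\<in>UNIV. if a \<in> {i, j} then -1 else 1)"
      by (auto simp: M_def intro!: prod.cong)
    also have "\<dots> = (\<Prod>a\<in>{i, j}. -1)"
      by (subst prod.inter_restrict [symmetric]) auto
    also have "\<dots> = 1" using \<open>i \<noteq> j\<close> by simp
    finally have "M \<in> level2_SL"
      by (auto simp: level2_SL_def M_def mat_def)
    moreover have "M *v v = vec_upd v j (- v $ j)"
    proof (subst vec_eq_iff, rule allI)
      fix a
      have "(M *v v) $ a = (\<Sum>b\<in>UNIV. if a = b then (if a = i \<or> a = j then - v $ b else v $ b) else 0)"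
        unfolding matrix_vector_mult_def vec_lambda_beta
        by (rule sum.cong) (auto simp: M_def)
      then show "(M *v v) $ a = vec_upd v j (- v $ j) $ a"
        using that(2) by (auto simp: vec_upd_def)
    qed
    ultimately show ?thesis using S that unfolding level2_invariant_def by metis
  qed
  have "vec_upd (vec_upd v j (- v $ j)) j (- vec_upd v j (- v $ j) $ j) = v"
    "vec_upd v j (- v $ j) $ i = 0"
    using assms(2,3) by (simp_all add: vec_upd_def vec_eq_iff)
  then show ?thesis using * assms(3) by metis
qed

lemma sum_vec_upd:
  fixes f :: "'a \<Rightarrow> nat" and v :: "'a ^ 'r"
  assumes "f x < f (v $ j)"
  shows "(\<Sum>a\<in>UNIV. f (vec_upd v j x $ a)) < (\<Sum>a\<in>UNIV. f (v $ a))"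
  by (rule sum_strict_mono_ex1) (use assms in \<open>auto simp: vec_upd_def intro!: bexI[of _ j]\<close>)

text \<open>Transvections run the Euclidean algorithm with even quotients, which ends in a vector with
  entries \<open>0, 1, -1\<close>; the remaining signs are removed by one further transvection or, if there is
  only one nonzero entry, by a diagonal matrix. The weight in the induction counts signs as well.\<close>

lemma level2_invariant_visible:
  fixes v :: "int ^ 'r"
  assumes S: "level2_invariant S" and r: "CARD('r) \<ge> 2" and v: "visible v"
  shows "v \<in> S \<longleftrightarrow> (\<chi> i. v $ i mod 2) \<in> S"
proof -
  \<comment> \<open>The factor 2 makes any drop in absolute value outweigh the sign bit, while
    replacing -1 by 1 still lowers the weight, from 3 to 2.\<close>
  define f :: "int \<Rightarrow> nat" where "f x = nat (2 * \<bar>x\<bar> + (if x < 0 then 1 else 0))" for x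
  show ?thesis using v
  proof (induction "\<Sum>a\<in>UNIV. f (v $ a)" arbitrary: v rule: less_induct)
    case (less v)
    \<comment> \<open>A single step of the descent. The condition on divisors carries visibility
      over to the new vector.\<close>
    have descend: ?case if "f x < f (v $ j)" "x mod 2 = v $ j mod 2"
      "\<And>d. vec_dvd d (vec_upd v j x) \<Longrightarrow> vec_dvd d v" "vec_upd v j x \<in> S \<longleftrightarrow> v \<in> S" for x j
    proof -
      have "visible (vec_upd v j x)" using that(3) less.prems by (auto simp: visible_iff)
      moreover have "(\<Sum>a\<in>UNIV. f (vec_upd v j x $ a)) < (\<Sum>a\<in>UNIV. f (v $ a))"
        by (rule sum_vec_upd) (rule that(1))
      moreover have "(\<chi> i. vec_upd v j x $ i mod 2) = (\<chi> i. v $ i mod 2)"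
        using that(2) by (simp add: vec_upd_def vec_eq_iff)
      ultimately show ?thesis using less.hyps[of "vec_upd v j x"] that(4) by simp
    qed
    have transvect: ?case if "f (v $ j + 2 * k * v $ i) < f (v $ j)" "i \<noteq> j" for i j k
    proof (rule descend)
      show "(v $ j + 2 * k * v $ i) mod 2 = v $ j mod 2"
        by (simp add: mod_eq_dvd_iff)
      show "vec_dvd d v" if d: "vec_dvd d (vec_upd v j (v $ j + 2 * k * v $ i))" for d
        unfolding vec_dvd_def
      proof
        have upd: "int d dvd (if a = j then v $ j + 2 * k * v $ i else v $ a)" for a
          using d by (simp add: vec_dvd_def vec_upd_def)
        have "int d dvd v $ j"
          using upd[of i] upd[of j] \<open>i \<noteq> j\<close> by (simp add: dvd_add_left_iff)
        then show "int d dvd v $ a" for a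
          using upd[of a] by (cases "a = j") auto
      qed
    qed (use that level2_invariant_transvection[OF S] in auto)
    show ?case
    proof (cases "\<exists>i j. v $ i \<noteq> 0 \<and> \<bar>v $ i\<bar> < \<bar>v $ j\<bar>")
      case True
      then obtain i j where ij: "v $ i \<noteq> 0" "\<bar>v $ i\<bar> < \<bar>v $ j\<bar>" by blast
      \<comment> \<open>The sign is chosen so that twice the smaller absolute value is subtracted
        from the larger one. With \<open>0 < a < b\<close> this gives an absolute value
        \<open>\<bar>b - 2 * a\<bar>\<close> below \<open>b\<close>.\<close>
      define k :: int where "k = (if v $ i < 0 \<longleftrightarrow> v $ j < 0 then -1 else 1)"
      have "\<bar>v $ j + 2 * k * v $ i\<bar> < \<bar>v $ j\<bar>" using ij by (auto simp: k_def)
      then have "f (v $ j + 2 * k * v $ i) < f (v $ j)" by (auto simp: f_def)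
      then show ?thesis using ij by (intro transvect) auto
    next
      case eq: False
      \<comment> \<open>When no reduction is possible, all nonzero entries share one absolute value.
        It divides the whole vector, so visibility makes it 1.\<close>
      have unit: "\<bar>v $ i\<bar> = 1" if "v $ i \<noteq> 0" for i
      proof -
        have "v $ a = 0 \<or> \<bar>v $ i\<bar> = \<bar>v $ a\<bar>" for a
          using eq that by (meson linorder_neqE)
        then have "v $ i dvd v $ a" for a
          using dvd_if_abs_eq dvd_0_right by metis
        then have "vec_dvd (nat \<bar>v $ i\<bar>) v"
          by (simp add: vec_dvd_def)
        then show ?thesis using less.prems by (auto simp: visible_iff)
      qed
      show ?thesis
      proof (cases "\<exists>j. v $ j < 0")
        case True
        then obtain j where "v $ j < 0" by blast
        then have j: "v $ j = -1" using unit[of j] by auto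
        have "\<not> CARD('r) \<le> Suc 0" using r by simp
        then have "\<exists>a b :: 'r. a \<noteq> b" by (subst (asm) card_le_Suc0_iff_eq) auto
        then obtain i where "i \<noteq> j" by metis
        show ?thesis
        proof (cases "v $ i = 0")
          case False
          then have "v $ i * v $ i = 1" using unit[of i] by (auto simp: abs_if split: if_splits)
          \<comment> \<open>Taking the multiplier to be \<open>v $ i\<close> itself turns the entry
            -1 into \<open>-1 + 2 * 1 = 1\<close>, whatever the sign of
            \<open>v $ i\<close>.\<close>
          then have "v $ j + 2 * v $ i * v $ i = 1" using j by simp
          then show ?thesis using \<open>i \<noteq> j\<close> j by (intro transvect[where k = "v $ i"]) (auto simp: f_def)
        next
          case True
          have "vec_dvd d v" if "vec_dvd d (vec_upd v j (- v $ j))" for d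
            using that by (auto simp: vec_dvd_def vec_upd_def split: if_splits)
          then show ?thesis
            using level2_invariant_sign_flip[OF S \<open>i \<noteq> j\<close> True] j
            by (intro descend[of "- v $ j"]) (auto simp: f_def)
        qed
      next
        case False
        have "v $ i mod 2 = v $ i" for i
        proof -
          have "v $ i \<ge> 0" using False by (auto simp: not_less)
          then show ?thesis using unit[of i] by (cases "v $ i = 0") auto
        qed
        then show ?thesis by simp
      qed
    qed
  qed
qed

theorem level2_invariant_has_density:
  fixes S :: "(int ^ 'r) set"
  assumes S: "level2_invariant S" and r: "CARD('r) \<ge> 2"
  obtains s where "has_density S s"
proof -
  \<comment> \<open>Membership in \<open>S\<close> is tested at the representative with entries 0
    and 1. The pair with \<open>c = 0\<close> does no harm: no visible vector lies in that class, so
    its \<open>visible_multiples\<close> is empty.\<close>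
  define I where "I K = {(d, c). d \<in> {1..K} \<and> c \<in> residues 2 \<and> int d *s c \<in> S}" for K
  define Q where "Q K = (\<Union>(d, c)\<in>I K. visible_multiples d c)" for K
  have iff: "int d *s z \<in> S \<longleftrightarrow> int d *s c \<in> S"
    if "visible z" "c \<in> residues 2" "z \<in> residue_class 2 c" for d z c
  proof -
    have "M *v (int d *s u) = int d *s (M *v u)" for M :: "int ^ 'r ^ 'r" and u
      by (simp add: matrix_vector_mult_def vec_eq_iff sum_distrib_left algebra_simps)
    \<comment> \<open>Scalars commute with matrices, so each gcd layer of \<open>S\<close>, divided
      by \<open>d\<close>, is again invariant and the orbit lemma applies to it.\<close>
    then have "level2_invariant {u. int d *s u \<in> S}"
      using S by (auto simp: level2_invariant_def) metis
    from level2_invariant_visible[OF this r \<open>visible z\<close>]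
    have "int d *s z \<in> S \<longleftrightarrow> int d *s (\<chi> i. z $ i mod 2) \<in> S" by simp
    moreover have "(\<chi> i. z $ i mod 2) = c"
      using residues_unique[of "\<chi> i. z $ i mod 2" 2 c z] residues_reduce[of 2 z] that by simp
    ultimately show ?thesis by simp
  qed
  have "\<exists>x. d > 0 \<longrightarrow> has_density (visible_multiples d c) x" for d and c :: "int ^ 'r"
    using has_density_visible_multiples[of d c] by blast
  then obtain x where x: "\<And>d (c :: int ^ 'r). d > 0 \<Longrightarrow> has_density (visible_multiples d c) (x d c)"
    by metis
  have "has_density (Q K) (\<Sum>(d, c)\<in>I K. x d c)" for K
  proof -
    have "finite (I K)"
      by (rule finite_subset[of _ "{1..K} \<times> residues 2"]) (auto simp: I_def residues_finite_card)
    moreover have "disjoint_family_on (\<lambda>(d, c). visible_multiples d c) (I K)"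
      unfolding disjoint_family_on_def
      by (clarsimp simp: I_def, rule visible_multiples_disjoint) auto
    ultimately have "has_density (\<Union>p\<in>I K. (\<lambda>(d, c). visible_multiples d c) p) (\<Sum>p\<in>I K. (\<lambda>(d, c). x d c) p)"
      by (rule has_density_UN) (auto simp: I_def intro!: x)
    then show ?thesis by (simp add: Q_def case_prod_unfold)
  qed
  moreover have "Q K \<subseteq> S" for K
    using iff by (fastforce simp: Q_def I_def visible_multiples_def)
  moreover have "S - Q K \<subseteq> divisible_tail K" for K
  proof
    fix w assume w: "w \<in> S - Q K"
    show "w \<in> divisible_tail K"
    proof (cases "w = 0")
      case True
      then show ?thesis by (auto simp: divisible_tail_def)
    next
      case False
      then obtain d z where dz: "d > 0" "visible z" "w = int d *s z" by (rule visible_decomposition)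
      define c where "c = (\<chi> i. z $ i mod 2)"
      have c: "c \<in> residues 2" "z \<in> residue_class 2 c"
        using residues_reduce[of 2 z] by (simp_all add: c_def)
      have "int d *s c \<in> S" using c iff dz w by blast
      have "w \<in> visible_multiples d c" using dz c by (auto simp: visible_multiples_def)
      then have "(d, c) \<notin> I K" using w by (auto simp: Q_def)
      then have "d > K" using dz(1) c \<open>int d *s c \<in> S\<close> by (simp add: I_def)
      moreover have "vec_dvd d w" by (simp add: dz vec_dvd_def)
      ultimately show ?thesis by (auto simp: divisible_tail_def)
    qed
  qed
  ultimately have "has_density S (lim (\<lambda>K. \<Sum>(d, c)\<in>I K. x d c))"
    by (intro has_density_approximation[of S Q]) blast+
  then show ?thesis by (rule that)
qed

section \<open>Sup-norm balls\<close>

text \<open>A real radius is allowed because boxes are later rescaled, to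
  \<open>\<rho> / real d\<close> in the divisor count and to \<open>R * s n\<close> in the local
  limit argument.\<close>

definition int_box :: "real \<Rightarrow> (int ^ 'r) set" where
  "int_box \<rho> = {z. \<forall>i. \<bar>real_of_int (z $ i)\<bar> \<le> \<rho>}"

lemma int_box_mono: "\<rho> \<le> \<rho>' \<Longrightarrow> int_box \<rho> \<subseteq> int_box \<rho>'"
  unfolding int_box_def by (blast intro: order_trans)

lemma int_box_finite: "finite (int_box \<rho> :: (int ^ 'r) set)"
  and card_int_box: "card (int_box \<rho> :: (int ^ 'r) set) = nat (2 * \<lfloor>\<rho>\<rfloor> + 1) ^ CARD('r)"
proof -
  have *: "\<bar>real_of_int x\<bar> \<le> \<rho> \<longleftrightarrow> - \<lfloor>\<rho>\<rfloor> \<le> x \<and> x \<le> \<lfloor>\<rho>\<rfloor>" for x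
  proof -
    have "\<bar>real_of_int x\<bar> \<le> \<rho> \<longleftrightarrow> \<bar>x\<bar> \<le> \<lfloor>\<rho>\<rfloor>" by (simp add: le_floor_iff)
    then show ?thesis by linarith
  qed
  have eq: "(int_box \<rho> :: (int ^ 'r) set) = {z. \<forall>i. ((\<chi> i. - \<lfloor>\<rho>\<rfloor>) :: int ^ 'r) $ i \<le> z $ i \<and>
      z $ i \<le> ((\<chi> i. \<lfloor>\<rho>\<rfloor>) :: int ^ 'r) $ i}"
    unfolding int_box_def * by simp
  show "finite (int_box \<rho> :: (int ^ 'r) set)"
    unfolding eq by (rule int_vec_box)
  show "card (int_box \<rho> :: (int ^ 'r) set) = nat (2 * \<lfloor>\<rho>\<rfloor> + 1) ^ CARD('r)"
    unfolding eq int_vec_box(2) by simp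
qed

lemma card_int_box_le:
  assumes "\<rho> \<ge> 0"
  shows "real (card (int_box \<rho> :: (int ^ 'r) set)) \<le> (2 * \<rho> + 1) ^ CARD('r)"
proof -
  have "real (nat (2 * \<lfloor>\<rho>\<rfloor> + 1)) \<le> 2 * \<rho> + 1" using assms by (simp add: of_nat_nat)
  then show ?thesis unfolding card_int_box of_nat_power by (intro power_mono) auto
qed

text \<open>Telescoping, from \<open>1 / (a + 1) ^ 2 \<le> 1 / a - 1 / (a + 1)\<close>.\<close>

lemma sum_inverse_squares_le:
  assumes "K > 0"
  shows "(\<Sum>d\<in>{K<..K + m}. 1 / real d ^ 2) \<le> 1 / real K - 1 / real (K + m)"
proof (induction m)
  case (Suc m)
  have "{K<..K + Suc m} = insert (K + Suc m) {K<..K + m}" by auto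
  then have "(\<Sum>d\<in>{K<..K + Suc m}. 1 / real d ^ 2)
      = 1 / real (K + Suc m) ^ 2 + (\<Sum>d\<in>{K<..K + m}. 1 / real d ^ 2)" by simp
  also have "1 / real (K + Suc m) ^ 2 \<le> 1 / real (K + m) - 1 / real (K + Suc m)"
  proof -
    define a where "a = real (K + m)"
    have "a > 0" using assms by (simp add: a_def)
    then have "1 / (a + 1) ^ 2 \<le> 1 / (a * (a + 1))"
      by (intro divide_left_mono) (auto simp: power2_eq_square)
    also have "\<dots> = 1 / a - 1 / (a + 1)" using \<open>a > 0\<close> by (simp add: field_simps)
    finally show ?thesis by (simp add: a_def add.commute add.left_commute)
  qed
  finally show ?case using Suc by linarith
qed simp

text \<open>The summand 1 accounts for the zero vector. A nonzero vector in the box divisible by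
  \<open>d\<close> forces \<open>d \<le> \<rho>\<close>, and dividing by \<open>d\<close> maps such
  vectors into a box of radius \<open>\<rho> / d\<close>. Since the dimension is at least 2, the
  counts are dominated by inverse squares, whose tail beyond \<open>K\<close> is at most
  \<open>1 / K\<close>.\<close>

lemma card_divisible_tail_le:
  assumes r: "CARD('r) \<ge> 2" and "\<rho> \<ge> 0" "K > 0"
  shows "real (card (divisible_tail K \<inter> int_box \<rho> :: (int ^ 'r) set)) \<le> 1 + (3 * \<rho>) ^ CARD('r) / real K"
proof -
  let ?r = "CARD('r)"
  define J where "J = {K<..K + nat \<lfloor>\<rho>\<rfloor>} \<inter> {d. real d \<le> \<rho>}"
  define B :: "nat \<Rightarrow> (int ^ 'r) set" where "B d = {z \<in> int_box \<rho>. vec_dvd d z}" for d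
  have fin: "finite (B d)" for d by (simp add: B_def int_box_finite)
  have cB: "real (card (B d)) \<le> (3 * \<rho>) ^ ?r * (1 / real d ^ 2)" if d: "d \<in> J" for d
  proof -
    have d0: "d > 0" "real d \<le> \<rho>" using d by (auto simp: J_def)
    have "B d \<subseteq> (\<lambda>z. int d *s z) ` int_box (\<rho> / real d)"
    proof
      fix z assume z: "z \<in> B d"
      have "z = int d *s (\<chi> i. z $ i div int d)"
        using z by (auto simp: vec_eq_iff B_def vec_dvd_def)
      moreover have "(\<chi> i. z $ i div int d) \<in> int_box (\<rho> / real d)"
        unfolding int_box_def
      proof (intro CollectI allI)
        fix i
        have "real_of_int (z $ i) = real d * real_of_int (z $ i div int d)"
        proof -
          have "z $ i = int d * (z $ i div int d)" using z by (simp add: B_def vec_dvd_def)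
          then show ?thesis by (metis of_int_mult of_int_of_nat_eq)
        qed
        moreover have "\<bar>real_of_int (z $ i)\<bar> \<le> \<rho>" using z by (auto simp: B_def int_box_def)
        ultimately show "\<bar>real_of_int ((\<chi> i. z $ i div int d) $ i)\<bar> \<le> \<rho> / real d"
          using d0 by (simp add: abs_mult field_simps)
      qed
      ultimately show "z \<in> (\<lambda>z. int d *s z) ` int_box (\<rho> / real d)" by blast
    qed
    then have "card (B d) \<le> card (int_box (\<rho> / real d) :: (int ^ 'r) set)"
      by (meson card_image_le card_mono finite_imageI int_box_finite order_trans)
    then have "real (card (B d)) \<le> real (card (int_box (\<rho> / real d) :: (int ^ 'r) set))" by simp
    also have "\<dots> \<le> (2 * (\<rho> / real d) + 1) ^ ?r"
      using assms by (intro card_int_box_le) auto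
    \<comment> \<open>Here \<open>1 \<le> \<rho> / real d\<close>, so the boundary term is absorbed
      into the constant 3.\<close>
    also have "\<dots> \<le> (3 * \<rho> / real d) ^ ?r"
      using d0 assms by (intro power_mono) (auto simp: field_simps)
    also have "\<dots> = (3 * \<rho>) ^ ?r * (1 / real d ^ ?r)" by (simp add: power_divide)
    also have "\<dots> \<le> (3 * \<rho>) ^ ?r * (1 / real d ^ 2)"
      using d0 r assms by (intro mult_left_mono divide_left_mono power_increasing) auto
    finally show ?thesis .
  qed
  have "divisible_tail K \<inter> int_box \<rho> \<subseteq> insert 0 (\<Union>d\<in>J. B d)"
  proof
    fix z :: "int ^ 'r" assume z: "z \<in> divisible_tail K \<inter> int_box \<rho>"
    show "z \<in> insert 0 (\<Union>d\<in>J. B d)"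
    proof (cases "z = 0")
      case False
      then obtain i where i: "z $ i \<noteq> 0" by (auto simp: vec_eq_iff)
      obtain d where d: "d > K" "vec_dvd d z" using z by (auto simp: divisible_tail_def)
      then have "int d dvd z $ i" by (simp add: vec_dvd_def)
      then have "int d \<le> \<bar>z $ i\<bar>" using dvd_imp_le_int[OF i, of "int d"] by simp
      then have "real d \<le> \<bar>real_of_int (z $ i)\<bar>" by linarith
      also have "\<dots> \<le> \<rho>" using z by (auto simp: int_box_def)
      finally have "real d \<le> \<rho>" .
      moreover from this have "d \<le> nat \<lfloor>\<rho>\<rfloor>" by (simp add: le_nat_floor)
      ultimately have "d \<in> J" using d by (auto simp: J_def)
      then show ?thesis using z d by (auto simp: B_def)
    qed simp
  qed
  then have "card (divisible_tail K \<inter> int_box \<rho> :: (int ^ 'r) set) \<le> card (insert 0 (\<Union>d\<in>J. B d))"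
    by (intro card_mono) (auto simp: fin J_def)
  also have "\<dots> \<le> Suc (card (\<Union>d\<in>J. B d))" by (rule card_insert_le_m1) auto
  also have "card (\<Union>d\<in>J. B d) \<le> (\<Sum>d\<in>J. card (B d))"
    by (rule card_UN_le) (simp add: J_def)
  finally have "real (card (divisible_tail K \<inter> int_box \<rho> :: (int ^ 'r) set)) \<le> 1 + (\<Sum>d\<in>J. real (card (B d)))"
    by (simp flip: of_nat_sum)
  also have "(\<Sum>d\<in>J. real (card (B d))) \<le> (\<Sum>d\<in>J. (3 * \<rho>) ^ ?r * (1 / real d ^ 2))"
    by (rule sum_mono) (rule cB)
  also have "\<dots> = (3 * \<rho>) ^ ?r * (\<Sum>d\<in>J. 1 / real d ^ 2)" by (simp only: sum_distrib_left)
  also have "(\<Sum>d\<in>J. 1 / real d ^ 2) \<le> (\<Sum>d\<in>{K<..K + nat \<lfloor>\<rho>\<rfloor>}. 1 / real d ^ 2)"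
    by (rule sum_mono2) (auto simp: J_def)
  also have "\<dots> \<le> 1 / real K"
    using sum_inverse_squares_le[OF \<open>K > 0\<close>, of "nat \<lfloor>\<rho>\<rfloor>"] by (smt (verit) divide_nonneg_nonneg of_nat_0_le_iff)
  finally show ?thesis using assms by (simp add: mult_left_mono)
qed

text \<open>Outside a box of radius \<open>R * s n\<close> the mass is small by tightness. Inside,
  the point mass bound turns counting into mass: the powers of \<open>s n\<close> cancel and leave
  \<open>C * (3 * R) ^ r / K\<close> plus a vanishing contribution of the zero vector. Both balls
  and annuli obtain their tail condition from this.\<close>

lemma (in additive_sequence) tail_of_tight:
  fixes s :: "nat \<Rightarrow> real"
  assumes r: "CARD('r) \<ge> 2" and s: "filterlim s at_top sequentially"
    and tight: "\<And>\<epsilon>. \<epsilon> > 0 \<Longrightarrow> \<exists>R>0. \<forall>\<^sub>F n in sequentially. \<mu> n (- int_box (R * s n)) < \<epsilon>"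
    and bound: "\<forall>\<^sub>F n in sequentially. \<forall>z. \<mu> n {z} \<le> C / s n ^ CARD('r)"
    and "C > 0" "\<epsilon> > 0"
  shows "\<exists>K. \<forall>\<^sub>F n in sequentially. \<mu> n (divisible_tail K) < \<epsilon>"
proof -
  let ?r = "CARD('r)"
  obtain R where "R > 0" and R: "\<forall>\<^sub>F n in sequentially. \<mu> n (- int_box (R * s n)) < \<epsilon> / 3"
    using tight[of "\<epsilon> / 3"] \<open>\<epsilon> > 0\<close> by auto
  obtain K :: nat where K: "real K > 3 * (C * (3 * R) ^ ?r) / \<epsilon>"
    using reals_Archimedean2 by blast
  have "3 * (C * (3 * R) ^ ?r) / \<epsilon> > 0" using \<open>R > 0\<close> \<open>C > 0\<close> \<open>\<epsilon> > 0\<close> by simp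
  then have "K > 0" using K by (metis gr0I less_asym of_nat_0)
  have K3: "C * (3 * R) ^ ?r / real K < \<epsilon> / 3"
    using K \<open>K > 0\<close> \<open>\<epsilon> > 0\<close> by (simp add: field_simps)
  have "((\<lambda>n. C / s n ^ ?r) \<longlonglongrightarrow> 0)"
    using filterlim_compose[OF tendsto_divide_0[OF tendsto_const[of C]] s, of "\<lambda>x. x ^ ?r"]
    by (simp add: filterlim_at_top_imp_at_infinity filterlim_pow_at_top filterlim_ident)
  then have C3: "\<forall>\<^sub>F n in sequentially. C / s n ^ ?r < \<epsilon> / 3"
    using \<open>\<epsilon> > 0\<close> by (intro order_tendstoD(2)[of _ 0]) auto
  have s0: "\<forall>\<^sub>F n in sequentially. s n > 0"
    using s by (simp add: filterlim_at_top_dense)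
  have "\<forall>\<^sub>F n in sequentially. \<mu> n (divisible_tail K) < \<epsilon>"
    using R C3 s0 bound
  proof eventually_elim
    case (elim n)
    let ?T = "divisible_tail K \<inter> int_box (R * s n) :: (int ^ 'r) set"
    have "\<mu> n (divisible_tail K) \<le> \<mu> n (?T \<union> - int_box (R * s n))"
      by (rule mono) auto
    also have "\<dots> = \<mu> n ?T + \<mu> n (- int_box (R * s n))"
      by (rule disj_Un) auto
    also have "\<mu> n ?T = \<mu> n (\<Union>z\<in>?T. {z})" by simp
    also have "\<dots> = (\<Sum>z\<in>?T. \<mu> n {z})"
      by (rule UN_disjoint) (auto simp: disjoint_family_on_def int_box_finite)
    also have "\<dots> \<le> real (card ?T) * (C / s n ^ ?r)"
      using elim by (intro sum_bounded_above) auto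
    also have "\<dots> \<le> (1 + (3 * (R * s n)) ^ ?r / real K) * (C / s n ^ ?r)"
      using elim \<open>R > 0\<close> \<open>C > 0\<close> \<open>K > 0\<close>
      by (intro mult_right_mono card_divisible_tail_le r) auto
    also have "\<dots> = C / s n ^ ?r + C * (3 * R) ^ ?r / real K"
      using elim \<open>K > 0\<close> by (simp add: field_simps power_mult_distrib)
    finally show ?case using elim K3 by linarith
  qed
  then show ?thesis ..
qed

section \<open>Ball ratios as an admissible sequence\<close>

lemma infnorm_le_iff_int_box: "infnorm (of_int_vec z) \<le> \<rho> \<longleftrightarrow> z \<in> int_box \<rho>"
proof
  assume "infnorm (of_int_vec z) \<le> \<rho>"
  then show "z \<in> int_box \<rho>"
    using component_le_infnorm_cart[of "of_int_vec z"] order_trans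
    by (fastforce simp: int_box_def of_int_vec_def)
next
  assume "z \<in> int_box \<rho>"
  then show "infnorm (of_int_vec z) \<le> \<rho>"
    unfolding infnorm_cart by (intro cSup_least) (auto simp: int_box_def of_int_vec_def)
qed

lemma ball_ratio_int_box:
  "ball_ratio S n = real (card (S \<inter> int_box (real n))) / real (card (int_box (real n) :: (int ^ 'r) set))"
  for S :: "(int ^ 'r) set"
  by (simp add: ball_ratio_def infnorm_le_iff_int_box Int_def)

lemma card_int_box_real: "real (card (int_box (real n) :: (int ^ 'r) set)) = (2 * real n + 1) ^ CARD('r)"
  by (simp add: card_int_box nat_add_distrib nat_mult_distrib add.commute)

text \<open>Translating back moves the box into one whose radius is larger by \<open>T\<close>, so
  the error is at most the number of points in a shell. Using it for \<open>t\<close> and for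
  \<open>- t\<close> gives a two-sided bound.\<close>

lemma card_translate_int_box_le:
  fixes t :: "int ^ 'r"
  assumes t: "t \<in> int_box (real T)"
  shows "card ((+) t ` X \<inter> int_box (real n)) \<le> card (X \<inter> int_box (real n))
      + (card (int_box (real (n + T)) :: (int ^ 'r) set) - card (int_box (real n) :: (int ^ 'r) set))"
proof -
  let ?B = "\<lambda>n. int_box (real n) :: (int ^ 'r) set"
  have "(+) t ` X \<inter> ?B n \<subseteq> (+) t ` (X \<inter> ?B (n + T))"
  proof
    fix w assume "w \<in> (+) t ` X \<inter> ?B n"
    then obtain x where x: "x \<in> X" "w = t + x" "w \<in> ?B n" by auto
    have "x \<in> ?B (n + T)"
      unfolding int_box_def
    proof (intro CollectI allI)
      fix i
      have "\<bar>real_of_int (w $ i)\<bar> \<le> real n" "\<bar>real_of_int (t $ i)\<bar> \<le> real T"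
        using x(3) t by (auto simp: int_box_def)
      then show "\<bar>real_of_int (x $ i)\<bar> \<le> real (n + T)" using x(2) by auto
    qed
    then show "w \<in> (+) t ` (X \<inter> ?B (n + T))" using x by blast
  qed
  then have "card ((+) t ` X \<inter> ?B n) \<le> card ((+) t ` (X \<inter> ?B (n + T)))"
    by (rule card_mono[rotated]) (simp add: int_box_finite)
  also have "\<dots> = card (X \<inter> ?B (n + T))" by (rule card_image) simp
  also have "\<dots> \<le> card ((X \<inter> ?B n) \<union> (?B (n + T) - ?B n))"
    by (rule card_mono) (auto simp: int_box_finite)
  also have "\<dots> \<le> card (X \<inter> ?B n) + card (?B (n + T) - ?B n)" by (rule card_Un_le)
  also have "card (?B (n + T) - ?B n) = card (?B (n + T)) - card (?B n)"
    by (intro card_Diff_subset int_box_finite int_box_mono) simp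
  finally show ?thesis by simp
qed

theorem asymptotic_density_ball_ratio:
  assumes r: "CARD('r) \<ge> 2"
  shows "asymptotic_density (\<lambda>n X. ball_ratio (X :: (int ^ 'r) set) n)"
proof -
  let ?r = "CARD('r)"
  let ?B = "\<lambda>n. int_box (real n) :: (int ^ 'r) set"
  interpret additive_sequence "\<lambda>n X. ball_ratio (X :: (int ^ 'r) set) n"
  proof
    fix X Y :: "(int ^ 'r) set" and n assume "X \<inter> Y = {}"
    then show "ball_ratio (X \<union> Y) n = ball_ratio X n + ball_ratio Y n"
      unfolding ball_ratio_int_box Int_Un_distrib2
      by (subst card_Un_disjoint) (auto simp: int_box_finite add_divide_distrib)
  qed (simp add: ball_ratio_int_box)
  show ?thesis
  proof
    show "(\<lambda>n. ball_ratio (UNIV :: (int ^ 'r) set) n) \<longlonglongrightarrow> 1"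
      by (simp add: ball_ratio_int_box card_int_box_real add_nonneg_eq_0_iff)
  next
    fix t :: "int ^ 'r" and X :: "(int ^ 'r) set"
    obtain T :: nat where T: "\<And>i. nat \<bar>t $ i\<bar> \<le> T"
      using finite_nat_set_iff_bounded_le[of "range (\<lambda>i. nat \<bar>t $ i\<bar>)"] by auto
    have "\<bar>real_of_int (t $ i)\<bar> \<le> real T" for i using T[of i] by linarith
    then have tT: "t \<in> int_box (real T)" "- t \<in> int_box (real T)"
      by (auto simp: int_box_def)
    have "(\<lambda>n. ((2 * real (n + T) + 1) ^ ?r - (2 * real n + 1) ^ ?r) / (2 * real n + 1) ^ ?r) \<longlonglongrightarrow> 0"
    proof -
      have "(\<lambda>n. (2 * real (n + T) + 1) / (2 * real n + 1)) \<longlonglongrightarrow> 1" by real_asymp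
      then have "(\<lambda>n. ((2 * real (n + T) + 1) / (2 * real n + 1)) ^ ?r - 1) \<longlonglongrightarrow> 1 ^ ?r - 1"
        by (intro tendsto_intros)
      then show ?thesis by (simp add: power_divide diff_divide_distrib add_nonneg_eq_0_iff)
    qed
    moreover have "\<bar>ball_ratio ((+) t ` X) n - ball_ratio X n\<bar>
        \<le> ((2 * real (n + T) + 1) ^ ?r - (2 * real n + 1) ^ ?r) / (2 * real n + 1) ^ ?r" for n
    proof -
      have le: "card (?B n) \<le> card (?B (n + T))"
        by (intro card_mono int_box_finite int_box_mono) simp
      have "(+) (- t) ` (+) t ` X = X" by (simp add: image_image)
      then have "card (X \<inter> ?B n) \<le> card ((+) t ` X \<inter> ?B n) + (card (?B (n + T)) - card (?B n))"
        using card_translate_int_box_le[OF tT(2), of "(+) t ` X" n] by simp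
      with card_translate_int_box_le[OF tT(1), of X n]
      have "\<bar>real (card ((+) t ` X \<inter> ?B n)) - real (card (X \<inter> ?B n))\<bar> \<le> real (card (?B (n + T)) - card (?B n))"
        by linarith
      then have "\<bar>real (card ((+) t ` X \<inter> ?B n)) - real (card (X \<inter> ?B n))\<bar>
          \<le> (2 * real (n + T) + 1) ^ ?r - (2 * real n + 1) ^ ?r"
        unfolding of_nat_diff[OF le] card_int_box_real .
      then have "\<bar>(real (card ((+) t ` X \<inter> ?B n)) - real (card (X \<inter> ?B n))) / (2 * real n + 1) ^ ?r\<bar>
          \<le> ((2 * real (n + T) + 1) ^ ?r - (2 * real n + 1) ^ ?r) / (2 * real n + 1) ^ ?r"
        by (simp add: abs_divide divide_right_mono)
      then show ?thesis unfolding ball_ratio_int_box card_int_box_real diff_divide_distrib .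
    qed
    then have "\<forall>\<^sub>F n in sequentially. norm (ball_ratio ((+) t ` X) n - ball_ratio X n)
        \<le> ((2 * real (n + T) + 1) ^ ?r - (2 * real n + 1) ^ ?r) / (2 * real n + 1) ^ ?r"
      unfolding real_norm_def by (intro always_eventually allI)
    ultimately show "(\<lambda>n. ball_ratio ((+) t ` X) n - ball_ratio X n) \<longlonglongrightarrow> 0"
      by (rule Lim_null_comparison[rotated])
  next
    fix \<epsilon> :: real assume "\<epsilon> > 0"
    show "\<exists>K. \<forall>\<^sub>F n in sequentially. ball_ratio (divisible_tail K :: (int ^ 'r) set) n < \<epsilon>"
    proof (rule tail_of_tight[OF r filterlim_real_sequentially, where C = 1])
      show "\<exists>R>0. \<forall>\<^sub>F n in sequentially. ball_ratio (- int_box (R * real n) :: (int ^ 'r) set) n < \<epsilon>'" if "\<epsilon>' > 0" for \<epsilon>'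
        \<comment> \<open>With scale \<open>n\<close> and \<open>R = 1\<close> the complement of the
          ball carries no mass at all.\<close>
        using that by (intro exI[of _ 1]) (simp add: ball_ratio_int_box)
      show "\<forall>\<^sub>F n in sequentially. \<forall>z :: int ^ 'r. ball_ratio {z} n \<le> 1 / real n ^ ?r"
        using eventually_gt_at_top[of 0]
      proof eventually_elim
        case (elim n)
        show ?case
        proof
          fix z :: "int ^ 'r"
          have "card ({z} \<inter> ?B n) \<le> card {z}" by (rule card_mono) auto
          then have "ball_ratio {z} n \<le> 1 / (2 * real n + 1) ^ ?r"
            unfolding ball_ratio_int_box card_int_box_real by (intro divide_right_mono) auto
          also have "\<dots> \<le> 1 / real n ^ ?r"
            using elim by (intro divide_left_mono power_mono) auto
          finally show "ball_ratio {z} n \<le> 1 / real n ^ ?r" .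
        qed
      qed
    qed (use \<open>\<epsilon> > 0\<close> in auto)
  qed
qed

lemma has_density_strict_density:
  fixes X :: "(int ^ 'r) set"
  assumes "CARD('r) \<ge> 2" "has_density X x"
  shows "has_strict_density X" "strict_density X = x"
proof -
  have "ball_ratio X \<longlonglongrightarrow> x"
    using assms asymptotic_density_ball_ratio by (auto simp: has_density_def)
  then show "has_strict_density X" "strict_density X = x"
    by (auto simp: has_strict_density_def strict_density_def convergent_def limI)
qed

section \<open>The densities of the visible vectors\<close>

text \<open>Ball ratios supply an admissible sequence, so \<open>has_density\<close> is not vacuous
  and limits along it are unique.\<close>

lemma has_density_unique:
  fixes X :: "(int ^ 'r) set"
  assumes "CARD('r) \<ge> 2" "has_density X x" "has_density X y"
  shows "x = y"
  using has_density_strict_density(2)[OF assms(1,2)] has_density_strict_density(2)[OF assms(1,3)] by simp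

text \<open>Points of \<open>d X\<close> in the ball of radius \<open>d * n\<close> correspond
  exactly to points of \<open>X\<close> in the ball of radius \<open>n\<close>, while the volumes
  differ asymptotically by the factor \<open>d ^ r\<close>. The subsequence \<open>d * n\<close>
  suffices because the limit \<open>y\<close> is already known to exist.\<close>

lemma has_density_scale:
  fixes X :: "(int ^ 'r) set"
  assumes r: "CARD('r) \<ge> 2" and d: "d > 0"
    and X: "has_density X x" and Y: "has_density ((\<lambda>z. int d *s z) ` X) y"
  shows "y = x / real d ^ CARD('r)"
proof -
  let ?r = "CARD('r)"
  have lim: "(\<lambda>n. ball_ratio X n) \<longlonglongrightarrow> x" "(\<lambda>n. ball_ratio ((\<lambda>z. int d *s z) ` X) n) \<longlonglongrightarrow> y"
    using X Y asymptotic_density_ball_ratio[OF r] by (auto simp: has_density_def)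
  have ev: "ball_ratio ((\<lambda>z. int d *s z) ` X) (d * n)
      = ball_ratio X n * ((2 * real n + 1) / (2 * (real d * real n) + 1)) ^ ?r" for n
  proof -
    have iff: "int d *s z \<in> int_box (real (d * n)) \<longleftrightarrow> z \<in> int_box (real n)" for z :: "int ^ 'r"
      using d by (simp add: int_box_def abs_mult)
    have "(\<lambda>z. int d *s z) ` X \<inter> int_box (real (d * n)) = (\<lambda>z. int d *s z) ` (X \<inter> int_box (real n))"
      using iff by blast
    moreover have "inj_on (\<lambda>z. int d *s z) (X \<inter> int_box (real n))"
      using d by (auto simp: inj_on_def vec_eq_iff)
    ultimately have "card ((\<lambda>z. int d *s z) ` X \<inter> int_box (real (d * n))) = card (X \<inter> int_box (real n))"
      by (simp add: card_image)
    then show ?thesis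
      unfolding ball_ratio_int_box card_int_box_real
      by (simp add: power_divide add_nonneg_eq_0_iff)
  qed
  have "(\<lambda>n. (2 * real n + 1) / (2 * (real d * real n) + 1)) \<longlonglongrightarrow> 1 / real d"
    using d by (real_asymp simp: field_simps)
  then have "(\<lambda>n. ball_ratio X n * ((2 * real n + 1) / (2 * (real d * real n) + 1)) ^ ?r)
      \<longlonglongrightarrow> x * (1 / real d) ^ ?r"
    by (rule tendsto_mult[OF lim(1) tendsto_power])
  moreover have "(\<lambda>n. ball_ratio ((\<lambda>z. int d *s z) ` X) (d * n)) \<longlonglongrightarrow> y"
    using LIMSEQ_subseq_LIMSEQ[OF lim(2), of "\<lambda>n. d * n"] d by (simp add: strict_mono_def comp_def)
  ultimately have "y = x * (1 / real d) ^ ?r"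
    unfolding ev by (rule LIMSEQ_unique[rotated])
  then show ?thesis by (simp add: power_divide)
qed

text \<open>The unknown density \<open>x\<close> solves a linear equation: the class of
  \<open>c\<close> has density \<open>1 / 2 ^ r\<close>, and it is exhausted by the odd multiples of
  its visible vectors, with densities \<open>x / d ^ r\<close>. The resulting factor of
  \<open>x\<close> is the sum over odd \<open>d\<close>.\<close>

lemma has_density_visible_class:
  fixes c :: "int ^ 'r"
  assumes r: "CARD('r) \<ge> 2" and c: "c \<in> residues 2" "c \<noteq> 0"
  shows "has_density (visible_multiples 1 c) (1 / ((2 ^ CARD('r) - 1) * zeta CARD('r)))"
proof -
  let ?r = "CARD('r)"
  obtain x where x: "has_density (visible_multiples 1 c) x"
    using has_density_visible_multiples[of 1 c] by auto
  have xd: "has_density (visible_multiples d c) (x / real d ^ ?r)" if d: "d > 0" for d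
  proof -
    obtain y where y: "has_density (visible_multiples d c) y"
      using has_density_visible_multiples[OF d, of c] by blast
    moreover have "visible_multiples d c = (\<lambda>z. int d *s z) ` visible_multiples 1 c"
      by (simp add: visible_multiples_def)
    ultimately show ?thesis using has_density_scale[OF r d x, of y] by simp
  qed
  define Q where "Q K = (\<Union>d\<in>{d. odd d \<and> d \<le> K}. visible_multiples d c)" for K
  define q where "q K = (\<Sum>d\<in>{d. odd d \<and> d \<le> K}. x / real d ^ ?r)" for K
  have "has_density (Q K) (q K)" for K
    unfolding Q_def q_def
  proof (rule has_density_UN)
    show "disjoint_family_on (\<lambda>d. visible_multiples d c) {d. odd d \<and> d \<le> K}"
      unfolding disjoint_family_on_def
    proof (intro ballI impI)
      fix a b assume "a \<in> {d. odd d \<and> d \<le> K}" "b \<in> {d. odd d \<and> d \<le> K}" "a \<noteq> b"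
      then show "visible_multiples a c \<inter> visible_multiples b c = {}"
        using c(1) by (intro visible_multiples_disjoint) (auto elim: oddE)
    qed
  qed (auto intro!: xd elim!: oddE)
  then have "has_density (residue_class 2 c) (lim q)"
    using residue_class_2_approximation[OF c, folded Q_def] by (intro has_density_approximation)
  moreover have "has_density (residue_class 2 c) (1 / 2 ^ ?r)"
    unfolding has_density_def
    using asymptotic_density.residue_class_limit[of _ 2 c] by (simp add: residues_finite_card)
  ultimately have "lim q = 1 / 2 ^ ?r" by (rule has_density_unique[OF r])
  moreover have "q \<longlonglongrightarrow> x * ((1 - 1 / 2 ^ ?r) * zeta ?r)"
  proof -
    have "q K = x * (\<Sum>n\<le>K. if odd n then 1 / real n ^ ?r else 0)" for K
    proof -
      have "q K = (\<Sum>d\<in>{d \<in> {..K}. odd d}. x / real d ^ ?r)"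
        by (simp add: q_def conj_commute)
      also have "\<dots> = (\<Sum>n\<le>K. if odd n then x / real n ^ ?r else 0)"
        by (rule sum.inter_filter) simp
      also have "\<dots> = x * (\<Sum>n\<le>K. if odd n then 1 / real n ^ ?r else 0)"
        unfolding sum_distrib_left by (rule sum.cong) auto
      finally show ?thesis .
    qed
    then have "q = (\<lambda>K. x * (\<Sum>n\<le>K. if odd n then 1 / real n ^ ?r else 0))" by blast
    moreover have "(\<lambda>K. \<Sum>n\<le>K. if odd n then 1 / real n ^ ?r else 0) \<longlonglongrightarrow> (1 - 1 / 2 ^ ?r) * zeta ?r"
      using odd_zeta_sums(1)[OF r] unfolding sums_def_le .
    ultimately show ?thesis by (simp only: tendsto_mult_left)
  qed
  ultimately have eq: "x * ((1 - 1 / 2 ^ ?r) * zeta ?r) = 1 / 2 ^ ?r" by (simp add: limI)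
  have "x * ((2 ^ ?r - 1) * zeta ?r) = x * ((1 - 1 / 2 ^ ?r) * zeta ?r) * 2 ^ ?r"
    by (simp add: field_simps)
  also have "\<dots> = 1" by (simp add: eq)
  finally have "x * ((2 ^ ?r - 1) * zeta ?r) = 1" .
  moreover from this have "(2 ^ ?r - 1) * zeta ?r \<noteq> 0" by (metis mult_zero_right zero_neq_one)
  ultimately have "x = 1 / ((2 ^ ?r - 1) * zeta ?r)"
    by (metis nonzero_eq_divide_eq)
  then show ?thesis using x by simp
qed

section \<open>Parity of the l1 norm and the count of classes modulo 2\<close>

lemma even_l1_norm_cong:
  assumes "z \<in> residue_class 2 c"
  shows "even (l1_norm z) \<longleftrightarrow> even (l1_norm c)"
proof -
  have "even (\<bar>z $ i\<bar> - \<bar>c $ i\<bar>)" for i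
  proof -
    have "even (z $ i - c $ i)" using assms by (simp add: residue_class_def mod_eq_dvd_iff)
    then show ?thesis by (auto simp: abs_if)
  qed
  then have "even (\<Sum>i\<in>UNIV. \<bar>z $ i\<bar> - \<bar>c $ i\<bar>)" by (intro dvd_sum)
  then have "even (l1_norm z - l1_norm c)" by (simp add: l1_norm_def sum_subtractf)
  then show ?thesis by simp
qed

text \<open>Exchanging 0 and 1 in one fixed coordinate is an involution that swaps even and odd
  residues.\<close>

lemma card_even_residues:
  "2 * card {c \<in> residues 2 :: (int ^ 'r) set. even (l1_norm c)} = 2 ^ CARD('r)"
proof -
  let ?E = "{c \<in> residues 2 :: (int ^ 'r) set. even (l1_norm c)}"
  let ?O = "{c \<in> residues 2 :: (int ^ 'r) set. odd (l1_norm c)}"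
  obtain i :: 'r where True by simp
  define h :: "int ^ 'r \<Rightarrow> int ^ 'r" where "h c = vec_upd c i (1 - c $ i)" for c
  have hh: "h (h c) = c" for c by (simp add: h_def vec_upd_def vec_eq_iff)
  have h: "h c \<in> residues 2" "odd (l1_norm (h c)) \<longleftrightarrow> even (l1_norm c)" if c: "c \<in> residues 2" for c
  proof -
    have c01: "0 \<le> c $ a" "c $ a < 2" for a using c by (auto simp: residues_def)
    show "h c \<in> residues 2"
    proof -
      have "0 \<le> 1 - c $ i" "1 - c $ i < 2" using c01[of i] by linarith+
      then show ?thesis using c01 by (simp add: residues_def h_def vec_upd_def)
    qed
    have "c $ i \<in> {0, 1}" using c01[of i] by auto
    then have "odd (\<bar>1 - c $ i\<bar> - \<bar>c $ i\<bar>)" by auto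
    moreover have "l1_norm (h c) - l1_norm c = \<bar>1 - c $ i\<bar> - \<bar>c $ i\<bar>"
      unfolding l1_norm_def
      by (subst (1 2) sum.remove[of _ i]) (auto simp: h_def vec_upd_def)
    ultimately have "odd (l1_norm (h c) - l1_norm c)" by simp
    then show "odd (l1_norm (h c)) \<longleftrightarrow> even (l1_norm c)" by simp
  qed
  have EO: "?E \<inter> ?O = {}" by blast
  have "bij_betw h ?E ?O"
    by (rule bij_betw_byWitness[where f' = h]) (use h hh in auto)
  then have "card ?E = card ?O" by (rule bij_betw_same_card)
  moreover have "card (residues 2 :: (int ^ 'r) set) = card ?E + card ?O"
  proof -
    have "residues 2 = ?E \<union> ?O" by blast
    then show ?thesis by (metis (no_types, lifting) EO card_Un_disjoint finite_Un residues_finite_card(1))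
  qed
  ultimately show ?thesis by (simp add: residues_finite_card)
qed

lemma has_density_visible_classes:
  fixes C :: "(int ^ 'r) set"
  assumes r: "CARD('r) \<ge> 2" and C: "C \<subseteq> residues 2 - {0}"
  shows "has_density (\<Union>c\<in>C. visible_multiples 1 c) (real (card C) / ((2 ^ CARD('r) - 1) * zeta CARD('r)))"
proof -
  have "finite C" using C residues_finite_card(1) finite_subset by blast
  moreover have "disjoint_family_on (visible_multiples 1) C"
    unfolding disjoint_family_on_def
  proof (intro ballI impI)
    fix a b assume "a \<in> C" "b \<in> C" "a \<noteq> b"
    then show "visible_multiples 1 a \<inter> visible_multiples 1 b = {}"
      using C by (intro visible_multiples_disjoint) auto
  qed
  ultimately have "has_density (\<Union>c\<in>C. visible_multiples 1 c) (\<Sum>c\<in>C. 1 / ((2 ^ CARD('r) - 1) * zeta CARD('r)))"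
    using C by (intro has_density_UN has_density_visible_class r) auto
  then show ?thesis by simp
qed

lemma visible_residue_class:
  assumes "visible z"
  shows "(\<chi> i. z $ i mod 2) \<in> residues 2 - {0}" "z \<in> visible_multiples 1 (\<chi> i. z $ i mod 2)"
proof -
  have "(\<chi> i. z $ i mod 2) \<noteq> 0"
  proof
    assume "(\<chi> i. z $ i mod 2) = 0"
    then have "vec_dvd 2 z" by (auto simp: vec_dvd_def vec_eq_iff)
    then show False using assms by (auto simp: visible_iff)
  qed
  then show "(\<chi> i. z $ i mod 2) \<in> residues 2 - {0}" "z \<in> visible_multiples 1 (\<chi> i. z $ i mod 2)"
    using residues_reduce[of 2 z] assms by (auto simp: visible_multiples_def)
qed

lemma has_density_visible_vecs:
  assumes r: "CARD('r) \<ge> 2"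
  shows "has_density (visible_vecs :: (int ^ 'r) set) (1 / zeta CARD('r))"
proof -
  have "(visible_vecs :: (int ^ 'r) set) = (\<Union>c\<in>residues 2 - {0}. visible_multiples 1 c)"
    using visible_residue_class by (fastforce simp: visible_vecs_def visible_multiples_def)
  moreover have "card (residues 2 - {0} :: (int ^ 'r) set) = 2 ^ CARD('r) - 1"
  proof -
    have "0 \<in> (residues 2 :: (int ^ 'r) set)" by (simp add: residues_def)
    then show ?thesis by (simp add: card_Diff_singleton residues_finite_card)
  qed
  ultimately have "has_density (visible_vecs :: (int ^ 'r) set)
      (real (2 ^ CARD('r) - 1) / ((2 ^ CARD('r) - 1) * zeta CARD('r)))"
    using has_density_visible_classes[OF r order_refl] by metis
  moreover have "(2 :: real) ^ CARD('r) - 1 \<noteq> 0"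
    using one_less_power[of "2 :: real" "CARD('r)"] r by linarith
  then have "real (2 ^ CARD('r) - 1) / ((2 ^ CARD('r) - 1) * zeta CARD('r)) = 1 / zeta CARD('r)"
    by (subst of_nat_diff) (simp_all del: right_minus_eq)
  ultimately show ?thesis by simp
qed

lemma has_density_even_visible_vecs:
  assumes r: "CARD('r) \<ge> 2"
  shows "has_density (even_visible_vecs :: (int ^ 'r) set)
    ((2 ^ CARD('r) - 2) / (2 * ((2 ^ CARD('r) - 1) * zeta CARD('r))))"
proof -
  let ?E = "{c \<in> residues 2. even (l1_norm c)} :: (int ^ 'r) set"
  have fin: "finite ?E" by (simp add: residues_finite_card)
  have z: "0 \<in> ?E" by (simp add: residues_def l1_norm_def)
  have eq: "even_visible_vecs = (\<Union>c\<in>?E - {0}. visible_multiples 1 c)"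
  proof (intro equalityI subsetI)
    fix z :: "int ^ 'r" assume z: "z \<in> even_visible_vecs"
    then have v: "visible z" "even (l1_norm z)" by (auto simp: even_visible_vecs_def visible_vecs_def)
    have "even (l1_norm ((\<chi> i. z $ i mod 2) :: int ^ 'r))"
      using v(2) even_l1_norm_cong[OF residues_reduce(2)[of 2 z]] by simp
    then show "z \<in> (\<Union>c\<in>?E - {0}. visible_multiples 1 c)"
      using visible_residue_class[OF v(1)] by blast
  next
    fix z assume "z \<in> (\<Union>c\<in>?E - {0}. visible_multiples 1 c)"
    then show "z \<in> even_visible_vecs"
      using even_l1_norm_cong by (auto simp: even_visible_vecs_def visible_vecs_def visible_multiples_def)
  qed
  \<comment> \<open>The zero class has even norm but contains no visible vector, which leaves
    \<open>2 ^ (r - 1) - 1\<close> classes.\<close>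
  have card: "real (card (?E - {0})) = (2 ^ CARD('r) - 2) / 2"
  proof -
    have "card ?E > 0" using fin z by (auto simp: card_gt_0_iff)
    moreover have "2 * real (card ?E) = 2 ^ CARD('r)"
      using arg_cong[OF card_even_residues[where 'r = 'r], of real]
      by (simp only: of_nat_mult of_nat_numeral of_nat_power)
    ultimately show ?thesis using z fin by (simp add: card_Diff_singleton of_nat_diff)
  qed
  have "has_density (even_visible_vecs :: (int ^ 'r) set)
      (real (card (?E - {0})) / ((2 ^ CARD('r) - 1) * zeta CARD('r)))"
    unfolding eq by (rule has_density_visible_classes[OF r]) blast
  then show ?thesis unfolding card by simp
qed

section \<open>Linear change of variables\<close>

text \<open>The measure of sheared closed boxes is extended to open boxes by linearity, and these
  determine Lebesgue measure.\<close>

lemma distr_lborel_shear: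
  fixes m n :: "'n :: finite"
  assumes "m \<noteq> n"
  defines "h \<equiv> \<lambda>x :: real ^ 'n. \<chi> i. if i = m then x $ m + x $ n else x $ i"
  shows "distr lborel borel h = lborel"
proof -
  let ?h' = "\<lambda>x :: real ^ 'n. \<chi> i. if i = m then x $ m - x $ n else x $ i"
  have lin: "linear h" "linear ?h'"
    by (auto intro!: linearI simp: h_def vec_eq_iff algebra_simps)
  then have [measurable]: "h \<in> borel_measurable borel" "?h' \<in> borel_measurable borel"
    by (auto intro!: borel_measurable_continuous_onI linear_continuous_on simp: linear_conv_bounded_linear)
  have inv: "h (?h' x) = x" "?h' (h x) = x" for x
    using assms by (auto simp: h_def vec_eq_iff)
  have cb: "measure lebesgue (h ` cbox a b) = 1 * measure lebesgue (cbox a b)" for a b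
  proof (cases "cbox a b = {}")
    case False
    \<comment> \<open>\<open>measure_shear_interval\<close> asks for boxes whose \<open>n\<close>-th
      lower bound is nonnegative. Translating by \<open>v\<close> makes that bound 0, and
      \<open>w\<close> undoes the translation after the shear.\<close>
    define v :: "real ^ 'n" where "v = (\<chi> i. if i = n then - a $ n else 0)"
    define w :: "real ^ 'n" where "w = (\<chi> i. if i = m \<or> i = n then a $ n else 0)"
    have "h x = w + h (v + x)" for x
      using assms by (auto simp: h_def v_def w_def vec_eq_iff)
    then have "h ` cbox a b = (+) w ` h ` (+) v ` cbox a b"
      unfolding image_image by (rule image_cong[OF refl])
    then have "measure lebesgue (h ` cbox a b) = measure lebesgue (h ` cbox (v + a) (v + b))"
      by (simp only: measure_translation cbox_translation)
    also have "\<dots> = measure lebesgue (cbox (v + a) (v + b))"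
      unfolding h_def
    proof (rule measure_shear_interval[OF \<open>m \<noteq> n\<close>])
      show "cbox (v + a) (v + b) \<noteq> {}" using False by (simp add: cbox_translation)
    qed (simp add: v_def)
    also have "\<dots> = measure lebesgue (cbox a b)"
      by (simp only: measure_translation cbox_translation)
    finally show ?thesis by simp
  qed simp
  \<comment> \<open>The inverse shear is treated first because its preimages are the images under
    \<open>h\<close> just measured; composing with \<open>h\<close> then gives the claim.\<close>
  have "lborel = distr lborel borel ?h'"
  proof (rule lborel_eqI)
    fix l u :: "real ^ 'n" assume le: "\<And>b. b \<in> Basis \<Longrightarrow> l \<bullet> b \<le> u \<bullet> b"
    have "?h' -` box l u = h ` box l u"
      using inv by (auto simp: image_iff) (metis inv(1))
    then have "emeasure (distr lborel borel ?h') (box l u) = emeasure lborel (h ` box l u)"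
      by (simp add: emeasure_distr)
    moreover have "emeasure lborel (h ` box l u) = ennreal (measure lebesgue (box l u))"
    proof -
      have "?h' -` box l u \<inter> space borel \<in> sets borel" by measurable
      then have "h ` box l u \<in> sets borel" using \<open>?h' -` box l u = h ` box l u\<close> by simp
      then have "emeasure lborel (h ` box l u) = emeasure lebesgue (h ` box l u)"
        by simp
      moreover have "h ` box l u \<in> lmeasurable \<and> 1 * measure lebesgue (box l u) = measure lebesgue (h ` box l u)"
        by (rule measure_linear_sufficient[OF lin(1) _ cb]) simp
      ultimately show ?thesis
        using emeasure_eq_ennreal_measure[OF fmeasurableD2, of "h ` box l u" lebesgue] by simp
    qed
    ultimately have "emeasure (distr lborel borel ?h') (box l u) = ennreal (measure lebesgue (box l u))"
      by (rule trans)
    also have "\<dots> = emeasure lborel (box l u)"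
      using le by (simp add: emeasure_lborel_box emeasure_lborel_box_eq)
    finally show "emeasure (distr lborel borel ?h') (box l u) = (\<Prod>b\<in>Basis. (u - l) \<bullet> b)"
      using le by (simp add: emeasure_lborel_box)
  qed simp
  then have "distr lborel borel h = distr (distr lborel borel ?h') borel h" by simp
  also have "\<dots> = distr lborel borel (h \<circ> ?h')" by (rule distr_distr) auto
  also have "h \<circ> ?h' = id" using inv(1) by (simp add: fun_eq_iff)
  finally show ?thesis by (simp add: id_def distr_id2)
qed

text \<open>A coordinate swap is a self-adjoint involution that permutes the basis, so the preimage
  of a box is a box with the same side lengths.\<close>

lemma distr_lborel_transpose:
  fixes m n :: "'n :: finite"
  defines "h \<equiv> \<lambda>x :: real ^ 'n. \<chi> i. x $ Transposition.transpose m n i"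
  shows "distr lborel borel h = lborel"
proof (rule lborel_eqI[symmetric])
  have "linear h" by (auto intro!: linearI simp: h_def vec_eq_iff)
  then have [measurable]: "h \<in> borel_measurable borel"
    by (auto intro!: borel_measurable_continuous_onI linear_continuous_on simp: linear_conv_bounded_linear)
  have hh: "h (h x) = x" for x by (simp add: h_def vec_eq_iff)
  have inner: "h x \<bullet> y = x \<bullet> h y" for x y
    unfolding inner_vec_def h_def
    by (rule sum.reindex_bij_witness[of _ "Transposition.transpose m n" "Transposition.transpose m n"]) auto
  have B: "h b \<in> Basis" if "b \<in> Basis" for b
  proof -
    obtain i where "b = axis i (1 :: real)" using \<open>b \<in> Basis\<close> by (auto simp: Basis_vec_def)
    then have "h b = axis (Transposition.transpose m n i) (1 :: real)"
      by (auto simp: h_def axis_def vec_eq_iff Transposition.transpose_def)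
    then show ?thesis by (auto simp: Basis_vec_def)
  qed
  fix l u :: "real ^ 'n" assume le: "\<And>b. b \<in> Basis \<Longrightarrow> l \<bullet> b \<le> u \<bullet> b"
  have "h -` box l u = box (h l) (h u)"
  proof (intro equalityI subsetI)
    fix x assume x: "x \<in> h -` box l u"
    have "h l \<bullet> b < x \<bullet> b \<and> x \<bullet> b < h u \<bullet> b" if "b \<in> Basis" for b
      using x B[OF that] hh[of b] by (auto simp: mem_box inner dest: bspec[of _ _ "h b"])
    then show "x \<in> box (h l) (h u)" by (simp add: mem_box)
  next
    fix x assume x: "x \<in> box (h l) (h u)"
    have "l \<bullet> b < h x \<bullet> b \<and> h x \<bullet> b < u \<bullet> b" if "b \<in> Basis" for b
      using x B[OF that] hh[of b] by (auto simp: mem_box inner dest: bspec[of _ _ "h b"])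
    then show "x \<in> h -` box l u" by (simp add: mem_box)
  qed
  then have "emeasure (distr lborel borel h) (box l u) = emeasure lborel (box (h l) (h u))"
    by (simp add: emeasure_distr)
  also have "\<dots> = (\<Prod>b\<in>Basis. (h u - h l) \<bullet> b)"
    using le B by (intro emeasure_lborel_box) (simp add: inner)
  also have "(\<Prod>b\<in>Basis. (h u - h l) \<bullet> b) = (\<Prod>b\<in>Basis. (u - l) \<bullet> b)"
    by (rule prod.reindex_bij_witness[of _ h h]) (auto simp: B hh inner inner_diff_left)
  finally show "emeasure (distr lborel borel h) (box l u) = (\<Prod>b\<in>Basis. (u - l) \<bullet> b)" .
qed simp

text \<open>The library version requires a well-ordered index type.\<close>

theorem nn_integral_matrix_change_of_variables:
  fixes A :: "real ^ 'n ^ 'n" and f :: "real ^ 'n \<Rightarrow> ennreal"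
  assumes "f \<in> borel_measurable borel" "det A \<noteq> 0"
  shows "ennreal \<bar>det A\<bar> * (\<integral>\<^sup>+x. f (A *v x) \<partial>lborel) = (\<integral>\<^sup>+x. f x \<partial>lborel)"
proof -
  \<comment> \<open>The function is quantified inside so that, for a product, the hypothesis on
    \<open>B\<close> can be used at \<open>\<lambda>x. f (A *v x)\<close>. The determinant condition
    is inside as well, which makes the case of a zero row vacuous.\<close>
  let ?P = "\<lambda>A :: real ^ 'n ^ 'n. \<forall>f \<in> borel_measurable borel. det A \<noteq> 0 \<longrightarrow>
    ennreal \<bar>det A\<bar> * (\<integral>\<^sup>+x. f (A *v x) \<partial>lborel) = (\<integral>\<^sup>+x. f x \<partial>lborel)"
  have meas [measurable]: "(*v) A \<in> borel_measurable borel" for A :: "real ^ 'n ^ 'n"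
    by (intro borel_measurable_continuous_onI matrix_vector_mult_linear_continuous_on)
  have distrI: "?P A" if "distr lborel borel ((*v) A) = lborel" "\<bar>det A\<bar> = 1" for A
  proof (intro ballI impI)
    fix f :: "real ^ 'n \<Rightarrow> ennreal" assume [measurable]: "f \<in> borel_measurable borel"
    have "(\<integral>\<^sup>+x. f x \<partial>lborel) = (\<integral>\<^sup>+x. f x \<partial>distr lborel borel ((*v) A))" using that by simp
    also have "\<dots> = (\<integral>\<^sup>+x. f (A *v x) \<partial>lborel)" by (rule nn_integral_distr) auto
    finally show "ennreal \<bar>det A\<bar> * (\<integral>\<^sup>+x. f (A *v x) \<partial>lborel) = (\<integral>\<^sup>+x. f x \<partial>lborel)"
      using that by simp
  qed
  have "?P A"
  proof (rule induct_matrix_elementary_alt)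
    fix A B :: "real ^ 'n ^ 'n" assume AB: "?P A" "?P B"
    show "?P (A ** B)"
    proof (intro ballI impI)
      fix f :: "real ^ 'n \<Rightarrow> ennreal" assume f [measurable]: "f \<in> borel_measurable borel"
      assume "det (A ** B) \<noteq> 0"
      then have nz: "det A \<noteq> 0" "det B \<noteq> 0" by (auto simp: det_mul)
      have "ennreal \<bar>det (A ** B)\<bar> * (\<integral>\<^sup>+x. f ((A ** B) *v x) \<partial>lborel)
          = ennreal \<bar>det A\<bar> * (ennreal \<bar>det B\<bar> * (\<integral>\<^sup>+x. f (A *v (B *v x)) \<partial>lborel))"
        by (simp add: det_mul abs_mult ennreal_mult matrix_vector_mul_assoc mult.assoc)
      also have "ennreal \<bar>det B\<bar> * (\<integral>\<^sup>+x. f (A *v (B *v x)) \<partial>lborel) = (\<integral>\<^sup>+x. f (A *v x) \<partial>lborel)"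
        by (rule AB(2)[rule_format, of "\<lambda>x. f (A *v x)"]) (use nz in \<open>auto intro: measurable_compose[OF meas f]\<close>)
      also have "ennreal \<bar>det A\<bar> * (\<integral>\<^sup>+x. f (A *v x) \<partial>lborel) = (\<integral>\<^sup>+x. f x \<partial>lborel)"
        using AB(1) nz f by blast
      finally show "ennreal \<bar>det (A ** B)\<bar> * (\<integral>\<^sup>+x. f ((A ** B) *v x) \<partial>lborel) = (\<integral>\<^sup>+x. f x \<partial>lborel)" .
    qed
  next
    fix A :: "real ^ 'n ^ 'n" and i assume "row i A = 0"
    then show "?P A" by (simp add: det_zero_row)
  next
    fix A :: "real ^ 'n ^ 'n" assume diag: "\<And>i j. i \<noteq> j \<Longrightarrow> A $ i $ j = 0"
    have det: "det A = (\<Prod>i\<in>UNIV. A $ i $ i)" by (rule det_diagonal) (use diag in auto)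
    show "?P A"
    proof (intro ballI impI)
      fix f :: "real ^ 'n \<Rightarrow> ennreal" assume f [measurable]: "f \<in> borel_measurable borel"
      assume nz: "det A \<noteq> 0"
      define c :: "real ^ 'n \<Rightarrow> real" where "c j = (A *v j) \<bullet> j" for j
      have cA: "c (axis i 1) = A $ i $ i" for i
        by (simp add: c_def inner_axis matrix_vector_mul_component inner_axis)
      \<comment> \<open>This writes the diagonal map in the shape used by
        \<open>lborel_affine_euclidean\<close>, with translation part 0.\<close>
      have T: "0 + (\<Sum>j\<in>Basis. (c j * (x \<bullet> j)) *\<^sub>R j) = A *v x" for x
      proof -
        have "(A *v x) \<bullet> j = c j * (x \<bullet> j)" if j: "j \<in> Basis" for j
        proof -
          obtain i where i: "j = axis i (1 :: real)" using j by (auto simp: Basis_vec_def)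
          have "(A *v x) $ i = (\<Sum>k\<in>UNIV. A $ i $ k * x $ k)" by (simp add: matrix_vector_mult_def)
          also have "\<dots> = (\<Sum>k\<in>UNIV. if k = i then A $ i $ i * x $ i else 0)"
            by (rule sum.cong) (use diag in auto)
          finally show ?thesis unfolding i cA by (simp add: inner_axis)
        qed
        then show ?thesis using euclidean_representation[of "A *v x"] by simp
      qed
      have "(\<Prod>j\<in>(Basis :: (real ^ 'n) set). \<bar>c j\<bar>) = (\<Prod>i\<in>UNIV. \<bar>c (axis i 1)\<bar>)"
        unfolding Basis_vec_def
        by (rule prod.reindex_cong[of "\<lambda>i. axis i 1"]) (auto simp: inj_on_def axis_eq_axis)
      then have prod: "(\<Prod>j\<in>(Basis :: (real ^ 'n) set). \<bar>c j\<bar>) = \<bar>det A\<bar>"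
        by (simp add: cA det abs_prod)
      have "c j \<noteq> 0" if "j \<in> Basis" for j
        using that nz cA by (auto simp: Basis_vec_def det)
      then have "lborel = density (distr lborel borel ((*v) A)) (\<lambda>_. ennreal \<bar>det A\<bar>)"
        using lborel_affine_euclidean[of c 0] unfolding T prod by simp
      then have "(\<integral>\<^sup>+x. f x \<partial>lborel) = (\<integral>\<^sup>+x. f x \<partial>density (distr lborel borel ((*v) A)) (\<lambda>_. ennreal \<bar>det A\<bar>))"
        by simp
      also have "\<dots> = (\<integral>\<^sup>+x. ennreal \<bar>det A\<bar> * f x \<partial>distr lborel borel ((*v) A))"
        by (rule nn_integral_density) auto
      also have "\<dots> = ennreal \<bar>det A\<bar> * (\<integral>\<^sup>+x. f x \<partial>distr lborel borel ((*v) A))"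
        by (rule nn_integral_cmult) auto
      also have "(\<integral>\<^sup>+x. f x \<partial>distr lborel borel ((*v) A)) = (\<integral>\<^sup>+x. f (A *v x) \<partial>lborel)"
        by (rule nn_integral_distr) auto
      finally show "ennreal \<bar>det A\<bar> * (\<integral>\<^sup>+x. f (A *v x) \<partial>lborel) = (\<integral>\<^sup>+x. f x \<partial>lborel)" ..
    qed
  next
    fix m n :: 'n assume "m \<noteq> n"
    let ?A = "\<chi> i j. mat 1 $ i $ Transposition.transpose m n j :: real ^ 'n ^ 'n"
    have "?A *v x = (\<chi> i. x $ Transposition.transpose m n i)" for x
    proof (subst vec_eq_iff, rule allI)
      fix i
      have "(?A *v x) $ i = (\<Sum>j\<in>UNIV. (if j = Transposition.transpose m n i then x $ j else 0))"
        unfolding matrix_vector_mult_def vec_lambda_beta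
        by (rule sum.cong) (auto simp: mat_def)
      then show "(?A *v x) $ i = (\<chi> i. x $ Transposition.transpose m n i) $ i" by simp
    qed
    then have "distr lborel borel ((*v) ?A) = lborel"
      using distr_lborel_transpose[of m n] by presburger
    moreover have "\<bar>det ?A\<bar> = 1"
      by (subst det_permute_columns) (simp_all add: permutes_swap_id sign_swap_id abs_mult \<open>m \<noteq> n\<close>)
    ultimately show "?P ?A" by (rule distrI)
  next
    fix m n :: 'n assume mn: "m \<noteq> n"
    let ?A = "\<chi> i j. of_bool (i = m \<and> j = n \<or> i = j) :: real ^ 'n ^ 'n"
    have "?A *v x = (\<chi> i. if i = m then x $ m + x $ n else x $ i)" for x
    proof (subst vec_eq_iff, rule allI)
      fix i
      have "(?A *v x) $ i = (\<Sum>j\<in>UNIV. (if j = i then x $ j else 0) + (if j = n then (if i = m then x $ j else 0) else 0))"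
        unfolding matrix_vector_mult_def vec_lambda_beta
        by (rule sum.cong) (use mn in auto)
      then show "(?A *v x) $ i = (\<chi> i. if i = m then x $ m + x $ n else x $ i) $ i"
        by (simp add: sum.distrib)
    qed
    then have "distr lborel borel ((*v) ?A) = lborel"
      using distr_lborel_shear[OF mn] by presburger
    moreover have "?A = (\<chi> l. if l = m then row m (mat 1) + 1 *s row n (mat 1) else row l (mat 1))"
      using mn by (auto simp: vec_eq_iff row_def mat_def)
    then have "det ?A = det (mat 1 :: real ^ 'n ^ 'n)"
      using det_row_operation[OF mn, of "mat 1 :: real ^ 'n ^ 'n" 1] by simp
    then have "\<bar>det ?A\<bar> = 1" by simp
    ultimately show "?P ?A" by (rule distrI)
  qed
  then show ?thesis using assms by blast
qed

section \<open>Gaussian densities\<close>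

text \<open>Gram-Schmidt for the inner product given by \<open>P\<close>. A new vector is taken
  Euclidean-orthogonal to all \<open>P *v f j\<close>; it exists because there are fewer of these
  than dimensions, and positivity permits its normalization.\<close>

lemma orthonormal_family_exists:
  fixes P :: "real ^ 'n ^ 'n" and J :: "'n set"
  assumes sym: "\<And>x y. (P *v x) \<bullet> y = x \<bullet> (P *v y)" and pos: "\<And>x. x \<noteq> 0 \<Longrightarrow> x \<bullet> (P *v x) > 0"
  shows "\<exists>f. \<forall>i\<in>J. \<forall>j\<in>J. f i \<bullet> (P *v f j) = (if i = j then 1 else 0)"
  using finite[of J]
proof (induction J rule: finite_induct)
  case (insert k J)
  then obtain f where f: "\<And>i j. i \<in> J \<Longrightarrow> j \<in> J \<Longrightarrow> f i \<bullet> (P *v f j) = (if i = j then 1 else 0)"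
    by blast
  let ?S = "(\<lambda>j. P *v f j) ` J"
  have "card J < CARD('n)"
    using insert by (intro psubset_card_mono) auto
  then have "dim ?S < DIM(real ^ 'n)"
    using dim_le_card'[of ?S] card_image_le[of J "\<lambda>j. P *v f j"] insert by simp
  then obtain x where x: "x \<noteq> 0" "\<And>y. y \<in> span ?S \<Longrightarrow> orthogonal x y"
    using orthogonal_to_subspace_exists by blast
  have xj: "x \<bullet> (P *v f j) = 0" "f j \<bullet> (P *v x) = 0" if "j \<in> J" for j
  proof -
    show "x \<bullet> (P *v f j) = 0"
      using x(2)[of "P *v f j"] that by (auto simp: orthogonal_def span_base)
    then show "f j \<bullet> (P *v x) = 0" by (metis sym inner_commute)
  qed
  define c where "c = 1 / sqrt (x \<bullet> (P *v x))"
  have "c * c * (x \<bullet> (P *v x)) = 1" using pos[OF x(1)] by (simp add: c_def)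
  then have cc: "(c *\<^sub>R x) \<bullet> (P *v (c *\<^sub>R x)) = 1"
    by (simp add: matrix_vector_mult_scaleR)
  have "\<forall>i\<in>insert k J. \<forall>j\<in>insert k J.
      (f(k := c *\<^sub>R x)) i \<bullet> (P *v (f(k := c *\<^sub>R x)) j) = (if i = j then 1 else 0)"
    using f xj cc insert(2) by (auto simp: matrix_vector_mult_scaleR)
  then show ?case by blast
qed simp

lemma gram_matrix_identity:
  fixes P :: "real ^ 'n ^ 'n"
  assumes "\<And>x y. (P *v x) \<bullet> y = x \<bullet> (P *v y)" "\<And>x. x \<noteq> 0 \<Longrightarrow> x \<bullet> (P *v x) > 0"
  obtains Q :: "real ^ 'n ^ 'n" where "transpose Q ** (P ** Q) = mat 1"
proof -
  have "\<exists>f. \<forall>i j :: 'n. f i \<bullet> (P *v f j) = (if i = j then 1 else 0)"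
    using orthonormal_family_exists[OF assms, of UNIV] by simp
  then obtain f where f: "\<forall>i j :: 'n. f i \<bullet> (P *v f j) = (if i = j then 1 else 0)" ..
  define Q :: "real ^ 'n ^ 'n" where "Q = (\<chi> a j. f j $ a)"
  have PQ: "(P ** Q) $ a $ j = (P *v f j) $ a" for a j
    by (simp add: matrix_matrix_mult_def matrix_vector_mult_def Q_def)
  have "(transpose Q ** (P ** Q)) $ i $ j = f i \<bullet> (P *v f j)" for i j
    unfolding matrix_matrix_mult_def[of "transpose Q"] vec_lambda_beta PQ
    by (simp add: inner_vec_def transpose_def Q_def)
  then have "transpose Q ** (P ** Q) = mat 1"
    using f by (simp add: vec_eq_iff mat_def)
  then show ?thesis by (rule that)
qed

lemma invertible_matrix_inv:
  assumes "invertible A"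
  shows "A ** matrix_inv A = mat 1" "matrix_inv A ** A = mat 1"
  using someI_ex[of "\<lambda>B. A ** B = mat 1 \<and> B ** A = mat 1"] assms
  unfolding invertible_def matrix_inv_def by auto

text \<open>Gram-Schmidt for the inverse of \<open>D\<close> yields a matrix \<open>Q\<close> whose
  columns are orthonormal for that form. The substitution \<open>x = Q y\<close> thus turns the
  exponent into the Euclidean one, and taking determinants gives
  \<open>(det Q)\<^sup>2 = det D\<close>.\<close>

lemma inverse_covariance_factorization:
  fixes D :: "real ^ 'n ^ 'n"
  assumes D: "sym_pos_def D"
  obtains Q :: "real ^ 'n ^ 'n" where "\<bar>det Q\<bar> = sqrt (det D)" "det D > 0"
    "\<forall>y. (Q *v y) \<bullet> (matrix_inv D *v (Q *v y)) = y \<bullet> y"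
proof -
  let ?P = "matrix_inv D"
  have sym: "(D *v x) \<bullet> y = x \<bullet> (D *v y)" for x y
  proof -
    have "transpose D = D" using D by (simp add: sym_pos_def_def)
    then have "D *v x = x v* D" by (metis transpose_matrix_vector)
    then show ?thesis by (simp add: dot_lmul_matrix)
  qed
  have pos: "x \<bullet> (D *v x) > 0" if "x \<noteq> 0" for x
    using D that by (simp add: sym_pos_def_def)
  have "\<forall>x. D *v x = 0 \<longrightarrow> x = 0" using pos by force
  then have "invertible D"
    by (simp add: invertible_left_inverse matrix_left_invertible_ker)
  then have inv: "D ** ?P = mat 1" "?P ** D = mat 1"
    by (simp_all add: invertible_matrix_inv)
  then have DP: "D *v (?P *v x) = x" for x by (simp add: matrix_vector_mul_assoc)
  have symP: "(?P *v x) \<bullet> y = x \<bullet> (?P *v y)" for x y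
    using sym[of "?P *v x" "?P *v y"] by (simp add: DP)
  have posP: "x \<bullet> (?P *v x) > 0" if "x \<noteq> 0" for x
  proof -
    have "?P *v x \<noteq> 0" using DP[of x] that by auto
    from pos[OF this] show ?thesis by (simp add: DP inner_commute)
  qed
  obtain Q :: "real ^ 'n ^ 'n" where Q: "transpose Q ** (?P ** Q) = mat 1"
    using gram_matrix_identity[OF symP posP] .
  have "det Q * (det ?P * det Q) = 1"
    using arg_cong[OF Q, of det] by (simp add: det_mul)
  moreover have "det D * det ?P = 1"
    using arg_cong[OF inv(1), of det] by (simp add: det_mul)
  ultimately have sq: "det D = (det Q)\<^sup>2" by algebra
  have nz: "det Q \<noteq> 0" using \<open>det Q * _ = 1\<close> by auto
  show ?thesis
  proof
    show "\<bar>det Q\<bar> = sqrt (det D)" unfolding sq by simp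
    show "det D > 0" unfolding sq using nz by simp
    show "\<forall>y. (Q *v y) \<bullet> (?P *v (Q *v y)) = y \<bullet> y"
    proof
      fix y
      have "(Q *v y) \<bullet> (?P *v (Q *v y)) = (y v* transpose Q) \<bullet> ((?P ** Q) *v y)"
        by (simp add: matrix_vector_mul_assoc)
      also have "\<dots> = y \<bullet> ((transpose Q ** (?P ** Q)) *v y)"
        by (simp add: dot_lmul_matrix matrix_vector_mul_assoc del: vector_transpose_matrix)
      finally show "(Q *v y) \<bullet> (?P *v (Q *v y)) = y \<bullet> y" by (simp add: Q)
    qed
  qed
qed

text \<open>For symmetric positive definite \<open>D\<close> this is the density of the centred
  normal law with covariance matrix \<open>D\<close>.\<close>

definition gaussian_density :: "real ^ 'n ^ 'n \<Rightarrow> real ^ 'n \<Rightarrow> real" where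
  "gaussian_density D x =
    exp (- (x \<bullet> (matrix_inv D *v x)) / 2) / (sqrt (det D) * (2 * pi) powr (real CARD('n) / 2))"

lemma gaussian_density_borel [measurable]: "gaussian_density D \<in> borel_measurable borel"
proof -
  have [measurable]: "(*v) (matrix_inv D) \<in> borel_measurable borel"
    by (intro borel_measurable_continuous_onI matrix_vector_mult_linear_continuous_on)
  show ?thesis unfolding gaussian_density_def[abs_def] by measurable
qed

lemma nn_integral_exp_norm:
  "(\<integral>\<^sup>+y. ennreal (exp (- ((y :: real ^ 'n) \<bullet> y) / 2) / (2 * pi) powr (real CARD('n) / 2)) \<partial>lborel) = 1"
proof -
  have sqrt_power: "(2 * pi) powr (real CARD('n) / 2) = sqrt (2 * pi) ^ CARD('n)"
    by (simp add: powr_half_sqrt[symmetric] powr_realpow[symmetric] powr_powr)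
  have "exp (- (y \<bullet> y) / 2) / (2 * pi) powr (real CARD('n) / 2) = (\<Prod>b\<in>Basis. std_normal_density (y \<bullet> b))"
    for y :: "real ^ 'n"
  proof -
    have "(\<Prod>b\<in>Basis. std_normal_density (y \<bullet> b))
        = (1 / sqrt (2 * pi)) ^ CARD('n) * exp (\<Sum>b\<in>Basis. - (y \<bullet> b)\<^sup>2 / 2)"
      by (simp only: std_normal_density_def prod.distrib prod_constant exp_sum[OF finite_Basis]) simp
    also have "(\<Sum>b\<in>Basis. - (y \<bullet> b)\<^sup>2 / 2) = - (y \<bullet> y) / 2"
      by (subst euclidean_inner) (simp add: sum_negf power2_eq_square flip: sum_divide_distrib)
    finally show ?thesis by (simp add: sqrt_power power_divide)
  qed
  then have "(\<integral>\<^sup>+y. ennreal (exp (- ((y :: real ^ 'n) \<bullet> y) / 2) / (2 * pi) powr (real CARD('n) / 2)) \<partial>lborel)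
      = (\<integral>\<^sup>+y. (\<Prod>b\<in>Basis. ennreal (std_normal_density ((y :: real ^ 'n) \<bullet> b))) \<partial>lborel)"
    by (simp add: prod_ennreal normal_density_nonneg)
  also have "\<dots> = (\<Prod>b\<in>(Basis :: (real ^ 'n) set). \<integral>\<^sup>+x. ennreal (std_normal_density x) \<partial>lborel)"
    by (rule nn_integral_lborel_prod) auto
  also have "(\<integral>\<^sup>+x. ennreal (std_normal_density x) \<partial>lborel) = 1"
    by (subst nn_integral_eq_integral) (auto simp: normal_density_nonneg)
  finally show ?thesis by simp
qed

lemma nn_integral_gaussian_density:
  fixes D :: "real ^ 'n ^ 'n"
  assumes D: "sym_pos_def D"
  shows "(\<integral>\<^sup>+x. ennreal (gaussian_density D x) \<partial>lborel) = 1"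
proof -
  obtain Q :: "real ^ 'n ^ 'n" where Q: "\<bar>det Q\<bar> = sqrt (det D)" "det D > 0"
    "\<forall>y. (Q *v y) \<bullet> (matrix_inv D *v (Q *v y)) = y \<bullet> y"
    by (rule inverse_covariance_factorization[OF D])
  have "det Q \<noteq> 0" using Q(1,2) by auto
  then have "(\<integral>\<^sup>+x. ennreal (gaussian_density D x) \<partial>lborel)
      = ennreal \<bar>det Q\<bar> * (\<integral>\<^sup>+y. ennreal (gaussian_density D (Q *v y)) \<partial>lborel)"
    by (intro nn_integral_matrix_change_of_variables[symmetric]) measurable
  also have "\<dots> = (\<integral>\<^sup>+y. ennreal \<bar>det Q\<bar> * ennreal (gaussian_density D (Q *v y)) \<partial>lborel)"
  proof (rule nn_integral_cmult[symmetric])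
    have [measurable]: "(*v) Q \<in> borel_measurable borel"
      by (intro borel_measurable_continuous_onI matrix_vector_mult_linear_continuous_on)
    show "(\<lambda>y. ennreal (gaussian_density D (Q *v y))) \<in> borel_measurable lborel" by measurable
  qed
  also have "\<dots> = (\<integral>\<^sup>+y. ennreal (exp (- ((y :: real ^ 'n) \<bullet> y) / 2) / (2 * pi) powr (real CARD('n) / 2)) \<partial>lborel)"
    using Q(1,2) by (simp add: gaussian_density_def Q(3)[rule_format] flip: ennreal_mult')
  finally show ?thesis unfolding nn_integral_exp_norm .
qed

text \<open>The derivative is bounded by 1 because \<open>\<bar>t\<bar> \<le> 1 + t\<^sup>2 / 2
  \<le> exp (t\<^sup>2 / 2)\<close>.\<close>

lemma exp_neg_half_square_lipschitz:
  "\<bar>exp (- a\<^sup>2 / 2) - exp (- b\<^sup>2 / 2)\<bar> \<le> \<bar>a - b\<bar>" for a b :: real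
proof -
  have "norm (exp (- a\<^sup>2 / 2) - exp (- b\<^sup>2 / 2)) \<le> 1 * norm (a - b)"
  proof (rule field_differentiable_bound)
    fix t :: real
    show "((\<lambda>t. exp (- t\<^sup>2 / 2)) has_field_derivative (- t * exp (- t\<^sup>2 / 2))) (at t within UNIV)"
      by (auto intro!: derivative_eq_intros simp: power2_eq_square)
    have "\<bar>t\<bar> \<le> 1 + t\<^sup>2 / 2"
      using sum_squares_bound[of 1 "\<bar>t\<bar>"] by (simp add: power2_eq_square)
    also have "\<dots> \<le> exp (t\<^sup>2 / 2)" by (rule exp_ge_add_one_self)
    finally show "norm (- t * exp (- t\<^sup>2 / 2)) \<le> 1"
      by (simp add: abs_mult exp_minus field_simps)
  qed auto
  then show ?thesis by simp
qed

text \<open>In the coordinates given by the inverse of \<open>Q\<close> the density is a function of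
  the Euclidean norm alone, so the one-variable estimate applies; \<open>K\<close> bounds the
  operator norm of the inverse.\<close>

lemma gaussian_density_lipschitz:
  fixes D :: "real ^ 'n ^ 'n"
  assumes D: "sym_pos_def D"
  obtains L where "L > 0" "\<And>x y. \<bar>gaussian_density D x - gaussian_density D y\<bar> \<le> L * norm (x - y)"
proof -
  obtain Q :: "real ^ 'n ^ 'n" where Q: "\<bar>det Q\<bar> = sqrt (det D)" "det D > 0"
    "\<forall>y. (Q *v y) \<bullet> (matrix_inv D *v (Q *v y)) = y \<bullet> y"
    by (rule inverse_covariance_factorization[OF D])
  let ?R = "matrix_inv Q"
  have "det Q \<noteq> 0" using Q(1,2) by auto
  then have QR: "Q *v (?R *v x) = x" for x
    by (simp add: matrix_vector_mul_assoc invertible_matrix_inv invertible_det_nz)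
  obtain K where K: "K > 0" "\<And>x. norm (?R *v x) \<le> norm x * K"
    using bounded_linear.pos_bounded[OF matrix_vector_mul_bounded_linear[of ?R]] by blast
  define c where "c = sqrt (det D) * (2 * pi) powr (real CARD('n) / 2)"
  have c: "c > 0" using Q(2) by (simp add: c_def)
  have g: "gaussian_density D x = exp (- (norm (?R *v x))\<^sup>2 / 2) / c" for x
    using Q(3)[rule_format, of "?R *v x"] by (simp add: gaussian_density_def c_def QR power2_norm_eq_inner)
  show ?thesis
  proof (rule that[of "K / c"])
    show "K / c > 0" using K c by simp
    fix x y
    have "\<bar>exp (- (norm (?R *v x))\<^sup>2 / 2) - exp (- (norm (?R *v y))\<^sup>2 / 2)\<bar> \<le> \<bar>norm (?R *v x) - norm (?R *v y)\<bar>"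
      by (rule exp_neg_half_square_lipschitz)
    also have "\<dots> \<le> norm (?R *v x - ?R *v y)" by (rule norm_triangle_ineq3)
    also have "\<dots> = norm (?R *v (x - y))" by (simp add: matrix_vector_mult_diff_distrib)
    also have "\<dots> \<le> norm (x - y) * K" by (rule K(2))
    finally have "\<bar>exp (- (norm (?R *v x))\<^sup>2 / 2) - exp (- (norm (?R *v y))\<^sup>2 / 2)\<bar> / c \<le> norm (x - y) * K / c"
      using c by (intro divide_right_mono) auto
    then show "\<bar>gaussian_density D x - gaussian_density D y\<bar> \<le> K / c * norm (x - y)"
      using c unfolding g by (simp add: mult.commute flip: diff_divide_distrib)
  qed
qed

lemma gaussian_density_bounds:
  fixes D :: "real ^ 'n ^ 'n"
  assumes D: "sym_pos_def D"
  obtains B where "B > 0" "\<And>x. 0 \<le> gaussian_density D x" "\<And>x. gaussian_density D x \<le> B"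
proof -
  obtain Q :: "real ^ 'n ^ 'n" where Q: "\<bar>det Q\<bar> = sqrt (det D)" "det D > 0"
    "\<forall>y. (Q *v y) \<bullet> (matrix_inv D *v (Q *v y)) = y \<bullet> y"
    by (rule inverse_covariance_factorization[OF D])
  define c where "c = sqrt (det D) * (2 * pi) powr (real CARD('n) / 2)"
  have c: "c > 0" using Q(2) by (simp add: c_def)
  have "det Q \<noteq> 0" using Q(1,2) by auto
  then have QR: "Q *v (matrix_inv Q *v x) = x" for x
    by (simp add: matrix_vector_mul_assoc invertible_matrix_inv invertible_det_nz)
  have "x \<bullet> (matrix_inv D *v x) \<ge> 0" for x
    using Q(3)[rule_format, of "matrix_inv Q *v x"] by (simp add: QR)
  then have "gaussian_density D x \<le> 1 / c" for x
    unfolding gaussian_density_def c_def[symmetric] using c by (intro divide_right_mono) auto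
  moreover have "0 \<le> gaussian_density D x" for x
    unfolding gaussian_density_def c_def[symmetric] using c by simp
  ultimately show ?thesis using that[of "1 / c"] c by simp
qed

section \<open>Weights satisfying a local limit theorem\<close>

text \<open>Every \<open>x\<close> in the cube lies in the cell whose corner comes from rounding
  \<open>s * x\<close> down. The distance to that corner is at most \<open>r / s\<close>, so the
  Lipschitz term covers the variation of \<open>g\<close>; rounding accounts for the extra 1 in the
  radius. An upper bound for the integral is enough, since tightness needs a lower bound for the
  mass in a box.\<close>

lemma riemann_sum_bound:
  fixes g :: "real ^ 'r \<Rightarrow> real"
  assumes g0: "\<And>x. 0 \<le> g x" and lip: "\<And>x y. \<bar>g x - g y\<bar> \<le> L * norm (x - y)" and "L \<ge> 0" and s: "s > 0"
  shows "(\<integral>\<^sup>+x. ennreal (g x) * indicator {x. \<forall>i. \<bar>x $ i\<bar> \<le> R} x \<partial>lborel)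
    \<le> ennreal (\<Sum>\<alpha>\<in>int_box (R * s + 1). (g (of_int_vec \<alpha> /\<^sub>R s) + L * real CARD('r) / s) / s ^ CARD('r))"
proof -
  let ?r = "CARD('r)"
  let ?I = "int_box (R * s + 1) :: (int ^ 'r) set"
  define c :: "int ^ 'r \<Rightarrow> real" where "c \<alpha> = g (of_int_vec \<alpha> /\<^sub>R s) + L * real ?r / s" for \<alpha>
  define C :: "int ^ 'r \<Rightarrow> (real ^ 'r) set"
    where "C \<alpha> = cbox (of_int_vec \<alpha> /\<^sub>R s) (of_int_vec \<alpha> /\<^sub>R s + (\<chi> i. 1 / s))" for \<alpha>
  have c0: "0 \<le> c \<alpha>" for \<alpha> using g0 s \<open>L \<ge> 0\<close> by (simp add: c_def)
  have mC: "emeasure lborel (C \<alpha>) = ennreal (1 / s ^ ?r)" for \<alpha>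
  proof -
    have b: "(\<chi> i. 1 / s) \<bullet> b = 1 / s" if "b \<in> Basis" for b :: "real ^ 'r"
      using that by (auto simp: Basis_vec_def inner_axis)
    have "emeasure lborel (C \<alpha>)
        = (\<Prod>b\<in>Basis. (of_int_vec \<alpha> /\<^sub>R s + (\<chi> i. 1 / s) - of_int_vec \<alpha> /\<^sub>R s) \<bullet> b)"
      unfolding C_def using s by (intro emeasure_lborel_cbox) (simp add: inner_add_left b)
    also have "(\<Prod>b\<in>Basis. (of_int_vec \<alpha> /\<^sub>R s + (\<chi> i. 1 / s) - of_int_vec \<alpha> /\<^sub>R s) \<bullet> b) = (1 / s) ^ ?r"
      by (simp add: b)
    finally show ?thesis by (simp add: power_divide)
  qed
  have "ennreal (g x) * indicator {x. \<forall>i. \<bar>x $ i\<bar> \<le> R} x \<le> (\<Sum>\<alpha>\<in>?I. ennreal (c \<alpha>) * indicator (C \<alpha>) x)" for x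
  proof (cases "\<forall>i. \<bar>x $ i\<bar> \<le> R")
    case True
    define \<alpha> :: "int ^ 'r" where "\<alpha> = (\<chi> i. \<lfloor>s * x $ i\<rfloor>)"
    have fl: "real_of_int (\<alpha> $ i) \<le> s * x $ i" "s * x $ i \<le> real_of_int (\<alpha> $ i) + 1" for i
      by (auto simp: \<alpha>_def intro: less_imp_le)
    have \<alpha>: "\<alpha> \<in> ?I"
      unfolding int_box_def
    proof (intro CollectI allI)
      fix i
      have "\<bar>s * x $ i\<bar> \<le> R * s" using True s by (simp add: abs_mult mult.commute)
      then show "\<bar>real_of_int (\<alpha> $ i)\<bar> \<le> R * s + 1" using fl[of i] by linarith
    qed
    have comp: "(of_int_vec \<alpha> /\<^sub>R s) $ i \<le> x $ i \<and> x $ i \<le> (of_int_vec \<alpha> /\<^sub>R s) $ i + 1 / s" for i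
      using fl[of i] s by (simp add: of_int_vec_def field_simps)
    then have xC: "x \<in> C \<alpha>" by (simp add: C_def mem_box_cart)
    have "norm (x - of_int_vec \<alpha> /\<^sub>R s) \<le> (\<Sum>i\<in>UNIV. \<bar>(x - of_int_vec \<alpha> /\<^sub>R s) $ i\<bar>)"
      by (rule norm_le_l1_cart)
    also have "\<dots> \<le> (\<Sum>i\<in>(UNIV :: 'r set). 1 / s)"
      using comp by (intro sum_mono) (auto simp: abs_le_iff algebra_simps intro: add_increasing s less_imp_le)
    finally have "norm (x - of_int_vec \<alpha> /\<^sub>R s) \<le> real ?r / s" by simp
    then have "L * norm (x - of_int_vec \<alpha> /\<^sub>R s) \<le> L * (real ?r / s)"
      using \<open>L \<ge> 0\<close> by (rule mult_left_mono)
    then have "g x \<le> c \<alpha>" using lip[of x "of_int_vec \<alpha> /\<^sub>R s"] by (simp add: c_def)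
    then have "ennreal (g x) \<le> ennreal (c \<alpha>) * indicator (C \<alpha>) x"
      using xC by (simp add: ennreal_leI)
    also have "\<dots> \<le> (\<Sum>\<alpha>\<in>?I. ennreal (c \<alpha>) * indicator (C \<alpha>) x)"
      using \<alpha> by (intro member_le_sum) (auto simp: int_box_finite)
    finally show ?thesis using True by simp
  qed simp
  then have "(\<integral>\<^sup>+x. ennreal (g x) * indicator {x. \<forall>i. \<bar>x $ i\<bar> \<le> R} x \<partial>lborel)
      \<le> (\<integral>\<^sup>+x. (\<Sum>\<alpha>\<in>?I. ennreal (c \<alpha>) * indicator (C \<alpha>) x) \<partial>lborel)"
    by (rule nn_integral_mono)
  also have "\<dots> = (\<Sum>\<alpha>\<in>?I. \<integral>\<^sup>+x. ennreal (c \<alpha>) * indicator (C \<alpha>) x \<partial>lborel)"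
    by (rule nn_integral_sum) (simp add: C_def)
  also have "\<dots> = (\<Sum>\<alpha>\<in>?I. ennreal (c \<alpha>) * emeasure lborel (C \<alpha>))"
    by (intro sum.cong refl nn_integral_cmult_indicator) (simp add: C_def)
  also have "\<dots> = (\<Sum>\<alpha>\<in>?I. ennreal (c \<alpha> / s ^ ?r))"
    using s c0 by (simp add: mC flip: ennreal_mult)
  also have "\<dots> = ennreal (\<Sum>\<alpha>\<in>?I. c \<alpha> / s ^ ?r)"
    using s c0 by (intro sum_ennreal) simp
  finally show ?thesis by (simp add: c_def)
qed

lemma mass_in_box:
  fixes g :: "real ^ 'r \<Rightarrow> real"
  assumes [measurable]: "g \<in> borel_measurable borel"
    and int: "(\<integral>\<^sup>+x. ennreal (g x) \<partial>lborel) = 1" and "\<epsilon> > 0"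
  obtains R where "R > 0" "ennreal (1 - \<epsilon>) < (\<integral>\<^sup>+x. ennreal (g x) * indicator {x. \<forall>i. \<bar>x $ i\<bar> \<le> R} x \<partial>lborel)"
proof -
  define B where "B k = {x :: real ^ 'r. \<forall>i. \<bar>x $ i\<bar> \<le> real (Suc k)}" for k :: nat
  have "B k = (\<Inter>i. {x. \<bar>x $ i\<bar> \<le> real (Suc k)})" for k by (auto simp: B_def)
  then have "closed (B k)" for k
    by (auto intro!: closed_INT closed_Collect_le continuous_intros)
  then have [measurable]: "B k \<in> sets borel" for k by (rule borel_closed)
  have "(SUP k. ennreal (g x) * indicator (B k) x) = ennreal (g x)" for x
  proof (rule antisym)
    show "(SUP k. ennreal (g x) * indicator (B k) x) \<le> ennreal (g x)"
      by (intro SUP_least) (auto simp: indicator_def)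
    obtain k :: nat where k: "norm x \<le> real k" using real_arch_simple by blast
    then have "x \<in> B k"
      using component_le_norm_cart[of x] by (auto simp: B_def intro: order_trans[OF _ order_trans[OF k]])
    then show "ennreal (g x) \<le> (SUP k. ennreal (g x) * indicator (B k) x)"
      by (intro SUP_upper2[of k]) auto
  qed
  then have "(\<integral>\<^sup>+x. (SUP k. ennreal (g x) * indicator (B k) x) \<partial>lborel) = 1" using int by simp
  also have "(\<integral>\<^sup>+x. (SUP k. ennreal (g x) * indicator (B k) x) \<partial>lborel)
      = (SUP k. \<integral>\<^sup>+x. ennreal (g x) * indicator (B k) x \<partial>lborel)"
  proof (rule nn_integral_monotone_convergence_SUP)
    show "incseq (\<lambda>k x. ennreal (g x) * indicator (B k) x)"
      by (auto simp: incseq_def le_fun_def indicator_def B_def intro: order_trans)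
  qed measurable
  finally have "ennreal (1 - \<epsilon>) < (SUP k. \<integral>\<^sup>+x. ennreal (g x) * indicator (B k) x \<partial>lborel)"
    using \<open>\<epsilon> > 0\<close> by (simp add: ennreal_less_one_iff)
  then obtain k where "ennreal (1 - \<epsilon>) < (\<integral>\<^sup>+x. ennreal (g x) * indicator (B k) x \<partial>lborel)"
    by (auto simp: less_SUP_iff)
  then show ?thesis by (intro that[of "real (Suc k)"]) (simp_all add: B_def)
qed

lemma eventually_small_over:
  fixes s :: "nat \<Rightarrow> real"
  assumes "filterlim s at_top sequentially" "\<delta> > 0"
  shows "\<forall>\<^sub>F n in sequentially. c / s n < \<delta>"
  using tendsto_divide_0[OF tendsto_const, of s sequentially c] filterlim_at_top_imp_at_infinity[OF assms(1)] assms(2)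
  by (intro order_tendstoD(2)[of _ 0]) auto

lemma divide_le_of_le:
  fixes a m d p :: real
  assumes "p > 0" "a \<le> p * m + d"
  shows "a / p \<le> m + d / p"
  using assms by (simp add: field_simps)

text \<open>A point \<open>\<alpha>\<close> stands for a cell of volume \<open>1 / s n ^ r\<close>
  around \<open>\<alpha> /\<^sub>R s n\<close>, so the last assumption says that the weights look
  like \<open>g\<close> at scale \<open>s n\<close>, uniformly in \<open>\<alpha>\<close>.\<close>

locale local_limit = additive_sequence \<mu>
  for \<mu> :: "nat \<Rightarrow> (int ^ 'r) set \<Rightarrow> real" +
  fixes s :: "nat \<Rightarrow> real" and g :: "real ^ 'r \<Rightarrow> real" and L B :: real
  assumes r: "CARD('r) \<ge> 2"
    and total: "(\<lambda>n. \<mu> n UNIV) \<longlonglongrightarrow> 1"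
    and s: "filterlim s at_top sequentially"
    and g_borel: "g \<in> borel_measurable borel"
    and g_bounds: "\<And>x. 0 \<le> g x" "\<And>x. g x \<le> B" "B > 0"
    and lipschitz: "\<And>x y. \<bar>g x - g y\<bar> \<le> L * norm (x - y)" "L > 0"
    and g_integral: "(\<integral>\<^sup>+x. ennreal (g x) \<partial>lborel) = 1"
    and local_limit: "\<And>\<epsilon>. \<epsilon> > 0 \<Longrightarrow>
      \<forall>\<^sub>F n in sequentially. \<forall>\<alpha>. \<bar>s n ^ CARD('r) * \<mu> n {\<alpha>} - g (of_int_vec \<alpha> /\<^sub>R s n)\<bar> < \<epsilon>"
begin

lemma sum_singletons: "finite X \<Longrightarrow> \<mu> n X = (\<Sum>z\<in>X. \<mu> n {z})"
  using UN_disjoint[of X "\<lambda>z. {z}" n] by (simp add: disjoint_family_on_def)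

lemma s_ge_1: "\<forall>\<^sub>F n in sequentially. s n \<ge> 1"
  using s by (simp add: filterlim_at_top)

lemma point_mass_bound: "\<forall>\<^sub>F n in sequentially. \<forall>z. \<mu> n {z} \<le> (B + 1) / s n ^ CARD('r)"
  using local_limit[of 1, OF zero_less_one] s_ge_1
proof eventually_elim
  case (elim n)
  show ?case
  proof
    fix z
    have "s n ^ CARD('r) * \<mu> n {z} \<le> B + 1"
      using elim(1)[rule_format, of z] g_bounds(2)[of "of_int_vec z /\<^sub>R s n"] by linarith
    moreover have "s n ^ CARD('r) > 0" using elim by simp
    ultimately show "\<mu> n {z} \<le> (B + 1) / s n ^ CARD('r)" by (simp add: field_simps)
  qed
qed

text \<open>The pointwise error cannot be summed over the whole lattice. The mass outside a box is
  instead bounded as the total minus the mass inside, and the latter is at least nearly the integral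
  of \<open>g\<close> over a large cube.\<close>

lemma tight:
  assumes "\<epsilon> > 0"
  shows "\<exists>R>0. \<forall>\<^sub>F n in sequentially. \<mu> n (- int_box (R * s n)) < \<epsilon>"
proof -
  let ?r = "CARD('r)"
  obtain R where R: "R > 0"
    "ennreal (1 - \<epsilon> / 3) < (\<integral>\<^sup>+x. ennreal (g x) * indicator {x. \<forall>i. \<bar>x $ i\<bar> \<le> R} x \<partial>lborel)"
    using mass_in_box[OF g_borel g_integral, of "\<epsilon> / 3"] \<open>\<epsilon> > 0\<close> by auto
  define W where "W = (2 * R + 3) ^ ?r"
  have W: "W > 0" using R by (simp add: W_def)
  \<comment> \<open>There are at most \<open>W * s n ^ r\<close> cells. Each has error
    \<open>2 * \<delta>\<close> before division by \<open>s n ^ r\<close>, one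
    \<open>\<delta>\<close> from the local limit and one from the Lipschitz term, which gives
    \<open>\<epsilon> / 3\<close> in total.\<close>
  define \<delta> where "\<delta> = \<epsilon> / (6 * W)"
  have \<delta>: "\<delta> > 0" "W * \<delta> = \<epsilon> / 6" using W \<open>\<epsilon> > 0\<close> by (simp_all add: \<delta>_def)
  have "\<forall>\<^sub>F n in sequentially. \<mu> n UNIV < 1 + \<epsilon> / 3"
    using order_tendstoD(2)[OF total] \<open>\<epsilon> > 0\<close> by simp
  then have "\<forall>\<^sub>F n in sequentially. \<mu> n (- int_box ((R + 1) * s n)) < \<epsilon>"
    using local_limit[OF \<delta>(1)] s_ge_1 eventually_small_over[OF s \<delta>(1), of "L * real ?r"]
  proof eventually_elim
    case (elim n)
    let ?I = "int_box (R * s n + 1) :: (int ^ 'r) set"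
    have sn: "s n \<noteq> 0" and sp: "s n ^ ?r > 0" using elim by simp_all
    have "(\<Sum>\<alpha>\<in>?I. (g (of_int_vec \<alpha> /\<^sub>R s n) + L * real ?r / s n) / s n ^ ?r)
        \<le> (\<Sum>\<alpha>\<in>?I. \<mu> n {\<alpha>} + 2 * \<delta> / s n ^ ?r)"
    proof (rule sum_mono)
      fix \<alpha>
      have "g (of_int_vec \<alpha> /\<^sub>R s n) + L * real ?r / s n \<le> s n ^ ?r * \<mu> n {\<alpha>} + 2 * \<delta>"
        using elim(2)[rule_format, of \<alpha>] elim(4) by linarith
      then show "(g (of_int_vec \<alpha> /\<^sub>R s n) + L * real ?r / s n) / s n ^ ?r \<le> \<mu> n {\<alpha>} + 2 * \<delta> / s n ^ ?r"
        by (rule divide_le_of_le[OF sp])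
    qed
    also have "\<dots> = \<mu> n ?I + real (card ?I) * (2 * \<delta> / s n ^ ?r)"
      by (simp add: sum.distrib sum_singletons[OF int_box_finite])
    also have "real (card ?I) * (2 * \<delta> / s n ^ ?r) \<le> (W * s n ^ ?r) * (2 * \<delta> / s n ^ ?r)"
    proof (rule mult_right_mono)
      have "real (card ?I) \<le> (2 * (R * s n + 1) + 1) ^ ?r"
        using R elim by (intro card_int_box_le) simp
      also have "\<dots> \<le> ((2 * R + 3) * s n) ^ ?r"
        using R elim by (intro power_mono) (auto simp: algebra_simps)
      finally show "real (card ?I) \<le> W * s n ^ ?r" by (simp add: W_def power_mult_distrib)
    qed (use sp \<delta> in simp)
    also have "(W * s n ^ ?r) * (2 * \<delta> / s n ^ ?r) = \<epsilon> / 3"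
      using sn \<delta>(2) by simp
    finally have sum_le: "(\<Sum>\<alpha>\<in>?I. (g (of_int_vec \<alpha> /\<^sub>R s n) + L * real ?r / s n) / s n ^ ?r) \<le> \<mu> n ?I + \<epsilon> / 3"
      by simp
    have "ennreal (1 - \<epsilon> / 3) < ennreal (\<Sum>\<alpha>\<in>?I. (g (of_int_vec \<alpha> /\<^sub>R s n) + L * real ?r / s n) / s n ^ ?r)"
      using elim lipschitz by (intro less_le_trans[OF R(2) riemann_sum_bound] g_bounds) auto
    then have "1 - \<epsilon> / 3 < (\<Sum>\<alpha>\<in>?I. (g (of_int_vec \<alpha> /\<^sub>R s n) + L * real ?r / s n) / s n ^ ?r)"
      by (metis ennreal_leI not_le)
    also note sum_le
    \<comment> \<open>Once \<open>s n \<ge> 1\<close>, the rounding margin 1 fits into one further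
      multiple of \<open>s n\<close>.\<close>
    also have "\<mu> n ?I \<le> \<mu> n (int_box ((R + 1) * s n))"
      using elim by (intro mono int_box_mono) (simp add: algebra_simps)
    finally have "1 - 2 * \<epsilon> / 3 < \<mu> n (int_box ((R + 1) * s n))" by linarith
    moreover have "\<mu> n UNIV = \<mu> n (int_box ((R + 1) * s n)) + \<mu> n (- int_box ((R + 1) * s n))"
      using disj_Un[of "int_box ((R + 1) * s n)" "- int_box ((R + 1) * s n)" n] by simp
    ultimately show ?case using elim(1) by linarith
  qed
  then show ?thesis using R(1) by (intro exI[of _ "R + 1"]) auto
qed

text \<open>The bound is uniform in \<open>X\<close>, so applying it to \<open>X\<close> with
  \<open>t\<close> and to the translate with \<open>- t\<close> controls both signs of the
  difference.\<close>

lemma shift_upper: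
  assumes "\<epsilon> > 0"
  shows "\<forall>\<^sub>F n in sequentially. \<forall>X. \<mu> n X \<le> \<mu> n ((+) t ` X) + \<epsilon>"
proof -
  let ?r = "CARD('r)"
  obtain R where R: "R > 0" and ev: "\<forall>\<^sub>F n in sequentially. \<mu> n (- int_box (R * s n)) < \<epsilon> / 3"
    using tight[of "\<epsilon> / 3"] \<open>\<epsilon> > 0\<close> by auto
  define W where "W = (2 * R + 1) ^ ?r"
  have W: "W > 0" using R by (simp add: W_def)
  \<comment> \<open>Now each point costs \<open>3 * \<delta>\<close>: the local limit at
    \<open>z\<close> and at \<open>t + z\<close>, and the Lipschitz estimate between them. This sums
    to \<open>\<epsilon> / 2\<close>, leaving room for the \<open>\<epsilon> / 3\<close> from
    outside the box.\<close>
  define \<delta> where "\<delta> = \<epsilon> / (6 * W)"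
  have \<delta>: "\<delta> > 0" "W * \<delta> = \<epsilon> / 6" using W \<open>\<epsilon> > 0\<close> by (simp_all add: \<delta>_def)
  show ?thesis
    using ev local_limit[OF \<delta>(1)] s_ge_1 eventually_small_over[OF s \<delta>(1), of "L * norm (of_int_vec t)"]
  proof eventually_elim
    case (elim n)
    have sn: "s n \<noteq> 0" and sp: "s n ^ ?r > 0" using elim by simp_all
    show ?case
    proof
      fix X :: "(int ^ 'r) set"
      let ?Y = "X \<inter> int_box (R * s n)"
      have fin: "finite ?Y" by (simp add: int_box_finite)
      have "\<mu> n X \<le> \<mu> n (?Y \<union> - int_box (R * s n))" by (rule mono) auto
      also have "\<dots> = \<mu> n ?Y + \<mu> n (- int_box (R * s n))" by (rule disj_Un) auto
      also have "\<mu> n ?Y = (\<Sum>z\<in>?Y. \<mu> n {z})" by (rule sum_singletons[OF fin])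
      also have "\<dots> \<le> (\<Sum>z\<in>?Y. \<mu> n {t + z} + 3 * \<delta> / s n ^ ?r)"
      proof (rule sum_mono)
        fix z
        have "of_int_vec z /\<^sub>R s n - of_int_vec (t + z) /\<^sub>R s n = - (of_int_vec t /\<^sub>R s n)"
          by (simp add: of_int_vec_def vec_eq_iff algebra_simps)
        then have "norm (of_int_vec z /\<^sub>R s n - of_int_vec (t + z) /\<^sub>R s n) = norm (of_int_vec t) / s n"
          using elim by (simp only: norm_minus_cancel norm_scaleR) (simp add: field_simps)
        then have "\<bar>g (of_int_vec z /\<^sub>R s n) - g (of_int_vec (t + z) /\<^sub>R s n)\<bar> \<le> L * norm (of_int_vec t) / s n"
          using lipschitz(1)[of "of_int_vec z /\<^sub>R s n" "of_int_vec (t + z) /\<^sub>R s n"] by simp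
        then have "s n ^ ?r * \<mu> n {z} \<le> s n ^ ?r * \<mu> n {t + z} + 3 * \<delta>"
          using elim(2)[rule_format, of z] elim(2)[rule_format, of "t + z"] elim(4) by linarith
        then show "\<mu> n {z} \<le> \<mu> n {t + z} + 3 * \<delta> / s n ^ ?r"
          using divide_le_of_le[OF sp, of "s n ^ ?r * \<mu> n {z}"] sn by simp
      qed
      also have "\<dots> = (\<Sum>z\<in>?Y. \<mu> n {t + z}) + real (card ?Y) * (3 * \<delta> / s n ^ ?r)"
        by (simp add: sum.distrib)
      also have "(\<Sum>z\<in>?Y. \<mu> n {t + z}) = \<mu> n ((+) t ` ?Y)"
        using sum_singletons[OF finite_imageI[OF fin], of n "(+) t"] by (simp add: sum.reindex)
      also have "\<dots> \<le> \<mu> n ((+) t ` X)" by (intro mono) blast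
      also have "real (card ?Y) * (3 * \<delta> / s n ^ ?r) \<le> (W * s n ^ ?r) * (3 * \<delta> / s n ^ ?r)"
      proof (rule mult_right_mono)
        have "card ?Y \<le> card (int_box (R * s n) :: (int ^ 'r) set)"
          by (intro card_mono int_box_finite) auto
        then have "real (card ?Y) \<le> real (card (int_box (R * s n) :: (int ^ 'r) set))" by simp
        also have "\<dots> \<le> (2 * (R * s n) + 1) ^ ?r"
          using R elim by (intro card_int_box_le) simp
        also have "\<dots> \<le> ((2 * R + 1) * s n) ^ ?r"
          using R elim by (intro power_mono) (auto simp: algebra_simps)
        finally show "real (card ?Y) \<le> W * s n ^ ?r" by (simp add: W_def power_mult_distrib)
      qed (use sp \<delta> in simp)
      also have "(W * s n ^ ?r) * (3 * \<delta> / s n ^ ?r) = \<epsilon> / 2"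
        using sn \<delta>(2) by simp
      finally show "\<mu> n X \<le> \<mu> n ((+) t ` X) + \<epsilon>" using elim(1) \<open>\<epsilon> > 0\<close> by linarith
    qed
  qed
qed

theorem asymptotic_density: "asymptotic_density \<mu>"
proof
  show "(\<lambda>n. \<mu> n UNIV) \<longlonglongrightarrow> 1" by (rule total)
  show "(\<lambda>n. \<mu> n ((+) t ` X) - \<mu> n X) \<longlonglongrightarrow> 0" for t X
  proof (rule tendstoI)
    fix \<epsilon> :: real assume "\<epsilon> > 0"
    have inv: "(+) (- t) ` (+) t ` X = X" by (simp add: image_image)
    from \<open>\<epsilon> > 0\<close> have "\<epsilon> / 2 > 0" by simp
    from shift_upper[OF this, of t] shift_upper[OF this, of "- t"]
    show "\<forall>\<^sub>F n in sequentially. dist (\<mu> n ((+) t ` X) - \<mu> n X) 0 < \<epsilon>"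
    proof eventually_elim
      case (elim n)
      have "\<mu> n X \<le> \<mu> n ((+) t ` X) + \<epsilon> / 2" "\<mu> n ((+) t ` X) \<le> \<mu> n X + \<epsilon> / 2"
        using elim(1)[rule_format, of X] elim(2)[rule_format, of "(+) t ` X"] inv by simp_all
      then show ?case using \<open>\<epsilon> > 0\<close> by (simp add: dist_real_def abs_less_iff)
    qed
  qed
  show "\<exists>K. \<forall>\<^sub>F n in sequentially. \<mu> n (divisible_tail K) < \<epsilon>" if "\<epsilon> > 0" for \<epsilon>
    using g_bounds(3) that by (intro tail_of_tight[OF r s tight point_mass_bound]) auto
qed

end

section \<open>Word lengths\<close>

locale finitely_generated_group = group F for F :: "('a, 'b) monoid_scheme" (structure) +
  fixes A :: "'a set"
  assumes finite_gens: "finite A" and gens_closed: "A \<subseteq> carrier F" and generates: "generate F A = carrier F"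
begin

abbreviation "letters \<equiv> A \<union> m_inv F ` A"
abbreviation "word_value ws \<equiv> foldr (mult F) ws \<one>"
abbreviation "word_sphere n \<equiv> {x \<in> carrier F. word_length F A x = n}"

lemma letters_closed: "letters \<subseteq> carrier F"
  using gens_closed by auto

lemma word_value_closed: "set ws \<subseteq> letters \<Longrightarrow> word_value ws \<in> carrier F"
  using letters_closed by (induction ws) auto

lemma word_value_append:
  "set ws \<subseteq> letters \<Longrightarrow> set vs \<subseteq> letters \<Longrightarrow> word_value (ws @ vs) = word_value ws \<otimes> word_value vs"
proof (induction ws)
  case (Cons a ws)
  then have "a \<in> carrier F" using letters_closed by auto
  with Cons show ?case by (simp add: m_assoc word_value_closed)
qed (simp add: word_value_closed)

lemma word_exists:
  assumes "x \<in> carrier F"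
  shows "\<exists>ws. set ws \<subseteq> letters \<and> word_value ws = x"
proof -
  have "x \<in> generate F A" using assms generates by simp
  then show ?thesis
  proof induction
    case one
    show ?case by (intro exI[of _ "[]"]) simp
  next
    case (incl h)
    then show ?case using gens_closed by (intro exI[of _ "[h]"]) auto
  next
    case (inv h)
    then show ?case using gens_closed by (intro exI[of _ "[inv h]"]) auto
  next
    case (eng h1 h2)
    then obtain ws vs where "set ws \<subseteq> letters" "word_value ws = h1" "set vs \<subseteq> letters" "word_value vs = h2"
      by blast
    then show ?case using word_value_append[of ws vs] by (intro exI[of _ "ws @ vs"]) auto
  qed
qed

lemma shortest_word:
  assumes "x \<in> carrier F"
  obtains ws where "length ws = word_length F A x" "set ws \<subseteq> letters" "word_value ws = x"
proof -
  have "\<exists>n ws. length ws = n \<and> set ws \<subseteq> letters \<and> word_value ws = x"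
    using word_exists[OF assms] by blast
  from LeastI_ex[OF this] show ?thesis
    using that unfolding word_length_def by blast
qed

lemma word_length_le: "set ws \<subseteq> letters \<Longrightarrow> word_length F A (word_value ws) \<le> length ws"
  unfolding word_length_def by (rule Least_le) blast

lemma finite_sphere: "finite (word_sphere n)"
proof -
  have "word_sphere n \<subseteq> (\<lambda>ws. word_value ws) ` {ws. set ws \<subseteq> letters \<and> length ws = n}"
  proof
    fix x assume x: "x \<in> word_sphere n"
    then obtain ws where "length ws = word_length F A x" "set ws \<subseteq> letters" "word_value ws = x"
      using shortest_word[of x] by auto
    with x show "x \<in> (\<lambda>ws. word_value ws) ` {ws. set ws \<subseteq> letters \<and> length ws = n}" by blast
  qed
  moreover have "finite letters" using finite_gens by simp
  then have "finite {ws. set ws \<subseteq> letters \<and> length ws = n}" by (rule finite_lists_length_eq)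
  ultimately show ?thesis by (rule finite_surj[rotated])
qed

text \<open>Dropping the first letter of a shortest word leaves a shortest word; otherwise a shorter
  spelling of the rest would shorten the whole.\<close>

lemma sphere_Suc_nonempty:
  assumes "word_sphere (Suc n) \<noteq> {}"
  shows "word_sphere n \<noteq> {}"
proof -
  obtain x where x: "x \<in> carrier F" "word_length F A x = Suc n" using assms by auto
  obtain us where us: "length us = Suc n" "set us \<subseteq> letters" "word_value us = x"
    using shortest_word[OF x(1)] x(2) by metis
  then obtain a ws where "us = a # ws" by (cases us) auto
  with us have ws: "length ws = n" "set (a # ws) \<subseteq> letters" "word_value (a # ws) = x" by auto
  let ?y = "word_value ws"
  have y: "?y \<in> carrier F" using ws by (intro word_value_closed) auto
  obtain vs where vs: "length vs = word_length F A ?y" "set vs \<subseteq> letters" "word_value vs = ?y"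
    by (rule shortest_word[OF y])
  have "word_length F A (word_value (a # vs)) \<le> length (a # vs)"
    using ws vs by (intro word_length_le) auto
  moreover have "word_value (a # vs) = x" using ws vs by simp
  ultimately have "n \<le> word_length F A ?y" using x vs by simp
  moreover have "word_length F A ?y \<le> n" using word_length_le[of ws] ws by simp
  ultimately show ?thesis using y by auto
qed

lemma spheres_nonempty:
  assumes "\<exists>n\<ge>N. word_sphere n \<noteq> {}"
  shows "word_sphere N \<noteq> {}"
proof -
  obtain k where "word_sphere (N + k) \<noteq> {}" using assms by (auto simp: le_iff_add)
  then show ?thesis
  proof (induction k)
    case (Suc k)
    then show ?case using sphere_Suc_nonempty[of "N + k"] by simp
  qed simp
qed

section \<open>Relative growth and annular ratios of preimages\<close>

lemma finite_growth: "T \<subseteq> carrier F \<Longrightarrow> finite {x \<in> T. word_length F A x = n}"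
  by (rule finite_subset[OF _ finite_sphere[of n]]) auto

lemma preimage_closed: "preimage F ab X \<subseteq> carrier F"
  by (auto simp: preimage_def)

lemma rel_growth_disjoint_Un:
  assumes "X \<inter> Y = {}"
  shows "rel_growth F A n (preimage F ab (X \<union> Y)) = rel_growth F A n (preimage F ab X) + rel_growth F A n (preimage F ab Y)"
proof -
  have "{x \<in> preimage F ab (X \<union> Y). word_length F A x = n}
      = {x \<in> preimage F ab X. word_length F A x = n} \<union> {x \<in> preimage F ab Y. word_length F A x = n}"
    by (auto simp: preimage_def)
  moreover have "{x \<in> preimage F ab X. word_length F A x = n} \<inter> {x \<in> preimage F ab Y. word_length F A x = n} = {}"
    using assms by (auto simp: preimage_def)
  ultimately show ?thesis
    by (simp add: rel_growth_def growth_def card_Un_disjoint finite_growth preimage_closed add_divide_distrib)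
qed

text \<open>The index \<open>Suc n\<close> pairs the spheres of radius \<open>n\<close> and
  \<open>n + 1\<close>, as in the local limit hypothesis, and avoids the truncated subtraction at
  0.\<close>

lemma additive_sequence_annular_ratio:
  "additive_sequence (\<lambda>n X. annular_ratio F A (preimage F ab X) (Suc n))"
proof
  show "annular_ratio F A (preimage F ab (X \<union> Y)) (Suc n)
      = annular_ratio F A (preimage F ab X) (Suc n) + annular_ratio F A (preimage F ab Y) (Suc n)"
    if "X \<inter> Y = {}" for X Y n
    unfolding annular_ratio_def rel_growth_disjoint_Un[OF that] by (simp only: distrib_left ac_simps)
qed (simp add: annular_ratio_def rel_growth_def)

lemma rel_growth_carrier: "word_sphere n \<noteq> {} \<Longrightarrow> rel_growth F A n (carrier F) = 1"
  using finite_sphere[of n] by (simp add: rel_growth_def growth_def)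

text \<open>Dividing the hypothesis by twice the square root of \<open>det D\<close> turns the sum
  over two spheres into their average and the exponential term into
  \<open>gaussian_density D\<close> at scale \<open>sqrt n\<close>.\<close>

theorem annular_ratio_asymptotic_density:
  fixes ab :: "'a \<Rightarrow> int ^ 'r" and D :: "real ^ 'r ^ 'r"
  assumes r: "CARD('r) \<ge> 2" and D: "sym_pos_def D"
    and local_limit:
      "uniform_limit UNIV
        (\<lambda>n \<alpha>. \<bar>sqrt (det D) * real n powr (real CARD('r) / 2) *
              (rel_growth F A n (preimage F ab {\<alpha>}) + rel_growth F A (n + 1) (preimage F ab {\<alpha>}))
            - 2 / (2 * pi) powr (real CARD('r) / 2) *
              exp (- (of_int_vec \<alpha> \<bullet> (matrix_inv D *v of_int_vec \<alpha>)) / (2 * real n))\<bar>)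
        (\<lambda>\<alpha>. 0) sequentially"
  shows "asymptotic_density (\<lambda>n X. annular_ratio F A (preimage F ab X) (Suc n))"
proof -
  let ?r = "CARD('r)"
  let ?\<mu> = "\<lambda>n X. annular_ratio F A (preimage F ab X) (Suc n)"
  let ?c = "sqrt (det D)" and ?p = "(2 * pi) powr (real ?r / 2)"
  let ?q = "\<lambda>\<alpha> :: int ^ 'r. of_int_vec \<alpha> \<bullet> (matrix_inv D *v of_int_vec \<alpha>)"
  let ?S = "\<lambda>n \<alpha>. rel_growth F A n (preimage F ab {\<alpha>}) + rel_growth F A (n + 1) (preimage F ab {\<alpha>})"
  have ll: "\<forall>\<^sub>F n in sequentially. \<forall>\<alpha>.
      \<bar>?c * real n powr (real ?r / 2) * ?S n \<alpha> - 2 / ?p * exp (- ?q \<alpha> / (2 * real n))\<bar> < \<epsilon>" if "\<epsilon> > 0" for \<epsilon>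
    using local_limit that by (simp add: uniform_limit_iff dist_real_def)
  have c: "?c > 0" using inverse_covariance_factorization[OF D] by (metis real_sqrt_gt_zero)
  have p: "?p > 0" by simp
  \<comment> \<open>An empty sphere would give the quotient \<open>0 / 0 = 0\<close> and destroy the
    total mass 1. If all spheres from \<open>N\<close> on were empty, the growth terms at the zero
    vector would vanish there, while the Gaussian term at that vector is the positive constant
    \<open>2 / ?p\<close>.\<close>
  have nonempty: "word_sphere N \<noteq> {}" for N
  proof (rule spheres_nonempty, rule ccontr)
    assume "\<not> (\<exists>n\<ge>N. word_sphere n \<noteq> {})"
    then have "{x \<in> preimage F ab {0}. word_length F A x = k} = {}" if "k \<ge> N" for k
      using that by (auto simp: preimage_def)
    then have "growth F A k (preimage F ab {0}) = 0" if "k \<ge> N" for k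
      using that unfolding growth_def by (metis card.empty)
    then have zero: "?S n 0 = 0" if "n \<ge> N" for n
      using that by (simp add: rel_growth_def)
    obtain n where "n \<ge> N"
      "\<bar>?c * real n powr (real ?r / 2) * ?S n 0 - 2 / ?p * exp (- ?q 0 / (2 * real n))\<bar> < 2 / ?p"
      using eventually_happens'[OF sequentially_bot eventually_conj[OF ll[of "2 / ?p"] eventually_ge_at_top[of N]]] p
      by auto
    moreover have "of_int_vec (0 :: int ^ 'r) = 0" by (simp add: of_int_vec_def vec_eq_iff)
    ultimately show False using zero[of n] p by simp
  qed
  obtain L where L: "L > 0" "\<And>x y. \<bar>gaussian_density D x - gaussian_density D y\<bar> \<le> L * norm (x - y)"
    using gaussian_density_lipschitz[OF D] by metis
  obtain B where B: "B > 0" "\<And>x. 0 \<le> gaussian_density D x" "\<And>x. gaussian_density D x \<le> B"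
    using gaussian_density_bounds[OF D] by metis
  have loc: "\<forall>\<^sub>F n in sequentially. \<forall>\<alpha>.
      \<bar>sqrt (real n) ^ ?r * ?\<mu> n {\<alpha>} - gaussian_density D (of_int_vec \<alpha> /\<^sub>R sqrt (real n))\<bar> < \<epsilon>" if "\<epsilon> > 0" for \<epsilon>
  proof -
    have "2 * ?c * \<epsilon> > 0" using c that by simp
    from ll[OF this] eventually_gt_at_top[of 0] show ?thesis
    proof eventually_elim
      case (elim n)
      show ?case
      proof
        fix \<alpha>
        have pw: "sqrt (real n) ^ ?r = real n powr (real ?r / 2)"
          using elim by (simp add: powr_half_sqrt[symmetric] powr_realpow[symmetric] powr_powr)
        have "(of_int_vec \<alpha> /\<^sub>R sqrt (real n)) \<bullet> (matrix_inv D *v (of_int_vec \<alpha> /\<^sub>R sqrt (real n))) = ?q \<alpha> / real n"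
          using elim by (simp add: matrix_vector_mult_scaleR field_simps)
        then have gd: "gaussian_density D (of_int_vec \<alpha> /\<^sub>R sqrt (real n)) = exp (- ?q \<alpha> / (2 * real n)) / (?c * ?p)"
          by (simp add: gaussian_density_def mult.commute)
        have \<mu>: "?\<mu> n {\<alpha>} = ?S n \<alpha> / 2" by (simp add: annular_ratio_def)
        have "sqrt (real n) ^ ?r * ?\<mu> n {\<alpha>} - gaussian_density D (of_int_vec \<alpha> /\<^sub>R sqrt (real n))
            = (?c * real n powr (real ?r / 2) * ?S n \<alpha> - 2 / ?p * exp (- ?q \<alpha> / (2 * real n))) / (2 * ?c)"
          unfolding pw gd \<mu> using c p by (simp add: diff_divide_distrib)
        also have "\<bar>\<dots>\<bar> < \<epsilon>"
          using elim(1)[rule_format, of \<alpha>] c by (simp add: abs_divide pos_divide_less_eq mult.commute)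
        finally show "\<bar>sqrt (real n) ^ ?r * ?\<mu> n {\<alpha>} - gaussian_density D (of_int_vec \<alpha> /\<^sub>R sqrt (real n))\<bar> < \<epsilon>" .
      qed
    qed
  qed
  have "preimage F ab UNIV = carrier F" by (simp add: preimage_def)
  then have "?\<mu> n UNIV = 1" for n
    using rel_growth_carrier[OF nonempty] by (simp add: annular_ratio_def)
  then have total: "(\<lambda>n. ?\<mu> n UNIV) \<longlonglongrightarrow> 1" by simp
  interpret additive_sequence ?\<mu> by (rule additive_sequence_annular_ratio)
  interpret local_limit ?\<mu> "\<lambda>n. sqrt (real n)" "gaussian_density D" L B
  proof
    show "filterlim (\<lambda>n. sqrt (real n)) at_top sequentially"
      by (rule filterlim_compose[OF sqrt_at_top filterlim_real_sequentially])
  qed (fact r total gaussian_density_borel B L nn_integral_gaussian_density[OF D] | rule loc)+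
  show ?thesis by (rule asymptotic_density)
qed

end

text \<open>At an even index the annular ratio of \<open>E\<close> sees only the even sphere, so it
  is half the relative growth of \<open>V\<close> there. The odd sphere is what remains of the
  annular ratio of \<open>V\<close>.\<close>

lemma tendsto_rel_growth_by_parity:
  assumes V: "annular_ratio F A V \<longlonglongrightarrow> v" and E: "annular_ratio F A E \<longlonglongrightarrow> e"
    and even: "E = {x \<in> V. even (word_length F A x)}"
  shows "(\<lambda>m. rel_growth F A (2 * m) V) \<longlonglongrightarrow> 2 * e"
    and "(\<lambda>m. rel_growth F A (2 * m - 1) V) \<longlonglongrightarrow> 2 * v - 2 * e"
proof -
  have sub: "strict_mono (\<lambda>m :: nat. 2 * m)" by (simp add: strict_mono_def)
  have V2: "(\<lambda>m. annular_ratio F A V (2 * m)) \<longlonglongrightarrow> v" and E2: "(\<lambda>m. annular_ratio F A E (2 * m)) \<longlonglongrightarrow> e"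
    using LIMSEQ_subseq_LIMSEQ[OF V sub] LIMSEQ_subseq_LIMSEQ[OF E sub] by (simp_all add: comp_def)
  \<comment> \<open>At \<open>m = 0\<close> truncated subtraction would make both spheres the one of
    radius 0, hence the restriction.\<close>
  have eq: "rel_growth F A (2 * m) V = 2 * annular_ratio F A E (2 * m)" if "m > 0" for m
  proof -
    have "{x \<in> E. word_length F A x = 2 * m - 1} = {}" "{x \<in> E. word_length F A x = 2 * m} = {x \<in> V. word_length F A x = 2 * m}"
      using that by (auto simp: even)
    then have "growth F A (2 * m - 1) E = 0" "growth F A (2 * m) E = growth F A (2 * m) V"
      unfolding growth_def by (simp_all only: card.empty)
    then show ?thesis by (simp add: annular_ratio_def rel_growth_def)
  qed
  have "\<forall>\<^sub>F m in sequentially. 2 * annular_ratio F A E (2 * m) = rel_growth F A (2 * m) V"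
    using eventually_gt_at_top[of 0] by eventually_elim (simp add: eq)
  then show lim: "(\<lambda>m. rel_growth F A (2 * m) V) \<longlonglongrightarrow> 2 * e"
    by (rule Lim_transform_eventually[OF tendsto_mult_left[OF E2]])
  have "(\<lambda>m. 2 * annular_ratio F A V (2 * m) - rel_growth F A (2 * m) V) \<longlonglongrightarrow> 2 * v - 2 * e"
    by (intro tendsto_diff tendsto_mult_left V2 lim)
  moreover have "2 * annular_ratio F A V (2 * m) - rel_growth F A (2 * m) V = rel_growth F A (2 * m - 1) V" for m
    unfolding annular_ratio_def mult.assoc[symmetric] by simp
  ultimately show "(\<lambda>m. rel_growth F A (2 * m - 1) V) \<longlonglongrightarrow> 2 * v - 2 * e"
    by simp
qed

theorem theorem4p11:
  fixes F :: "('a, 'b) monoid_scheme"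
    and A :: "'a set"
    and ab :: "'a \<Rightarrow> int ^ 'r"
    and D :: "real ^ 'r ^ 'r"
    and S :: "(int ^ 'r) set"
  assumes r: "CARD('r) \<ge> 2"
    and F: "group F"
    and A: "finite A" "A \<subseteq> carrier F" "generate F A = carrier F"
    and ab: "abelianization_map F ab"
    and D: "sym_pos_def D"
    and local_limit:
      "uniform_limit UNIV
        (\<lambda>n \<alpha>. \<bar>sqrt (det D) * real n powr (real CARD('r) / 2) *
              (rel_growth F A n (preimage F ab {\<alpha>}) + rel_growth F A (n + 1) (preimage F ab {\<alpha>}))
            - 2 / (2 * pi) powr (real CARD('r) / 2) *
              exp (- (of_int_vec \<alpha> \<bullet> (matrix_inv D *v of_int_vec \<alpha>)) / (2 * real n))\<bar>)
        (\<lambda>\<alpha>. 0) sequentially"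
    and S: "level2_invariant S"
  shows
    "(has_strict_annular_density F A (preimage F ab S) \<and> has_strict_density S \<and>
      strict_annular_density F A (preimage F ab S) = strict_density S)
     \<and>
     (preimage F ab even_visible_vecs =
        {v \<in> preimage F ab visible_vecs. even (word_length F A v)} \<longrightarrow>
      has_strict_density (visible_vecs :: (int ^ 'r) set) \<and>
      has_strict_density (even_visible_vecs :: (int ^ 'r) set) \<and>
      (\<lambda>m. rel_growth F A (2 * m) (preimage F ab visible_vecs))
        \<longlonglongrightarrow> 2 * strict_density (even_visible_vecs :: (int ^ 'r) set) \<and>
      2 * strict_density (even_visible_vecs :: (int ^ 'r) set) =
        (2 ^ CARD('r) - 2) / ((2 ^ CARD('r) - 1) * zeta CARD('r)) \<and>
      (\<lambda>m. rel_growth F A (2 * m - 1) (preimage F ab visible_vecs))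
        \<longlonglongrightarrow> 2 * strict_density (visible_vecs :: (int ^ 'r) set)
            - 2 * strict_density (even_visible_vecs :: (int ^ 'r) set) \<and>
      2 * strict_density (visible_vecs :: (int ^ 'r) set)
          - 2 * strict_density (even_visible_vecs :: (int ^ 'r) set) =
        2 ^ CARD('r) / ((2 ^ CARD('r) - 1) * zeta CARD('r)))"
proof -
  interpret finitely_generated_group F A
    using F A by (intro finitely_generated_group.intro finitely_generated_group_axioms.intro)
  \<comment> \<open>The admissible sequence is indexed by \<open>Suc n\<close>;
    \<open>filterlim_sequentially_Suc\<close> returns to the index of the annular ratio.\<close>
  have annular: "annular_ratio F A (preimage F ab X) \<longlonglongrightarrow> x" if "has_density X x" for X x
    using annular_ratio_asymptotic_density[OF r D local_limit] that filterlim_sequentially_Suc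
    unfolding has_density_def by blast
  let ?P = "2 ^ CARD('r) :: real" and ?z = "zeta CARD('r)"
  let ?V = "visible_vecs :: (int ^ 'r) set" and ?E = "even_visible_vecs :: (int ^ 'r) set"
  \<comment> \<open>The same number \<open>x\<close> is the limit along annuli and along balls,
    which is the equality claimed in part (i).\<close>
  obtain x where x: "has_density S x"
    using level2_invariant_has_density[OF S r] .
  note dens_S = annular[OF x] has_density_strict_density[OF r x]
  note V = has_density_visible_vecs[OF r] and E = has_density_even_visible_vecs[OF r]
  note dens_V = has_density_strict_density[OF r V]
  note dens_E = has_density_strict_density[OF r E]
  have "2 * (1 / z) - 2 * ((P - 2) / (2 * ((P - 1) * z))) = P / ((P - 1) * z)" if "P > 1" "z > 0" for P z :: real
    using that by (simp add: field_simps)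
  then have diff: "2 * (1 / ?z) - 2 * ((?P - 2) / (2 * ((?P - 1) * ?z))) = ?P / ((?P - 1) * ?z)"
    using odd_zeta_sums(2)[OF r] one_less_power[of "2 :: real" "CARD('r)"] r by simp
  have half: "2 * (a / (2 * b)) = a / b" for a b :: real by simp
  have parity: "(\<lambda>m. rel_growth F A (2 * m) (preimage F ab ?V)) \<longlonglongrightarrow> 2 * strict_density ?E"
    "(\<lambda>m. rel_growth F A (2 * m - 1) (preimage F ab ?V)) \<longlonglongrightarrow> 2 * strict_density ?V - 2 * strict_density ?E"
    if "preimage F ab ?E = {v \<in> preimage F ab ?V. even (word_length F A v)}"
    unfolding dens_V(2) dens_E(2)
    by (rule tendsto_rel_growth_by_parity[OF annular[OF V] annular[OF E] that])+
  show ?thesis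
  proof (intro conjI impI)
    show "has_strict_annular_density F A (preimage F ab S)"
      using dens_S(1) by (auto simp: has_strict_annular_density_def convergent_def)
    show "strict_annular_density F A (preimage F ab S) = strict_density S"
      using dens_S(1,3) by (simp add: strict_annular_density_def limI)
    show "2 * strict_density ?E = (?P - 2) / ((?P - 1) * ?z)"
      unfolding dens_E(2) by (rule half)
    show "2 * strict_density ?V - 2 * strict_density ?E = ?P / ((?P - 1) * ?z)"
      unfolding dens_V(2) dens_E(2) by (rule diff)
  qed (simp_all only: dens_S(2) dens_V(1) dens_E(1) parity)
qed

end
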